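(* Let $b\ge 2$ be an integer, let $\sigma$ be a permutation of $\{0,1,\dots,b-1\}$ with $\sigma\circ\tau=\tau\circ\sigma$ (where $\tau(k)=b-1-k$), let $n\ge 1$ be an integer, and let $\Sigma\in\{\sigma,\overline{\sigma}\}^n$, where $\overline{\sigma}=\tau\circ\sigma$. Then the symmetrized Hammersley point set $\mathcal{R}_{b,n}^{\Sigma,\mathrm{sym}}$ satisfies $$\left(2b^n\, L_2(\mathcal{R}_{b,n}^{\Sigma,\mathrm{sym}})\right)^2=n\,c_b^{\sigma}+\frac{11}{8}+\frac{1}{b^n}+\frac{1-9\cdot(-1)^b}{144\,b^{2n}},$$ where $c_b^{\sigma}:=2\Phi_b^{\sigma,(2)}+\widetilde{\Phi}_b^{\sigma}+\frac12\widetilde{\Phi}_{b,1}^{\sigma}+\frac12\widetilde{\Phi}_{b,2}^{\sigma}$.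
   Context: **Discrepancy.** For a finite point (multi)set $\mathcal{P}=\{x_0,\dots,x_{N-1}\}$ of $N$ points in $[0,1)^2$ and $x,y\in(0,1]$, let $E(x,y,\mathcal{P})=A([0,x)\times[0,y),\mathcal{P})-Nxy$, where $A([0,x)\times[0,y),\mathcal{P})$ is the number of indices $0\le m\le N-1$ with $x_m\in[0,x)\times[0,y)$. The $L_2$ discrepancy is $L_2(\mathcal{P})=\frac1N\left(\int_0^1\int_0^1|E(x,y,\mathcal{P})|^2\,dx\,dy\right)^{1/2}$. **Point sets.** Let $\mathfrak{S}_b$ be the set of permutations of $\{0,\dots,b-1\}$, $\tau\in\mathfrak{S}_b$, $\tau(k)=b-1-k$, and $\overline{\sigma}=\tau\circ\sigma$ for $\sigma\in\mathfrak{S}_b$. For $\Sigma=(\sigma_i)_{i=0}^{n-1}\in\mathfrak{S}_b^n$ let $$\mathcal{R}_{b,n}^{\Sigma}=\left\{\left(\sum_{i=0}^{n-1}\frac{\sigma_{n-1-i}(a_{n-1-i})}{b^{i+1}},\sum_{i=0}^{n-1}\frac{a_i}{b^{i+1}}\right):a_0,\dots,a_{n-1}\in\{0,\dots,b-1\}\right\}$$ ($b^n$ points). For $\Sigma=(\sigma_i)_{i=0}^{n-1}\in\{\sigma,\overline{\sigma}\}^n$ put $\Sigma^{\ast}=(\tau\circ\sigma_i)_{i=0}^{n-1}$. The symmetrized Hammersley point set is $\mathcal{R}_{b,n}^{\Sigma,\mathrm{sym}}=\mathcal{R}_{b,n}^{\Sigma}\cup\mathcal{R}_{b,n}^{\Sigma^{\ast}}$,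 the union being taken with multiplicity, so that it consists of exactly $2b^n$ points. **The functions $\varphi$.** Let $\sigma\in\mathfrak{S}_b$. For $h\in\{0,\dots,b-1\}$ and $x\in[(k-1)/b,k/b)$ with $k\in\{1,\dots,b\}$ define $$\varphi_{b,h}^{\sigma}(x)=\begin{cases}A([0,h/b);k)-hx & \text{if }0\le h\le\sigma(k-1),\\ (b-h)x-A([h/b,1);k)&\text{if }\sigma(k-1)<h<b,\end{cases}$$ where $A([u,v);k)$ is the number of indices $M\in\{1,\dots,k\}$ with $\sigma(M-1)/b\in[u,v)$. Extend $\varphi_{b,h}^{\sigma}$ to $\mathbb{R}$ with period $1$. Set $$\varphi_b^{\sigma,(2)}=\sum_{h=0}^{b-1}(\varphi_{b,h}^{\sigma})^2,\quad \widetilde{\varphi}_b^{\sigma}=\sum_{h=0}^{b-1}\varphi_{b,h}^{\sigma}\varphi_{b,h}^{\overline{\sigma}},\quad \widetilde{\varphi}_{b,1}^{\sigma}=\sum_{h=0}^{b-2}\varphi_{b,h+1}^{\sigma}\varphi_{b,h}^{\overline{\sigma}},\quad \widetilde{\varphi}_{b,2}^{\sigma}=\sum_{h=0}^{b-2}\varphi_{b,h}^{\sigma}\varphi_{b,h+1}^{\overline{\sigma}},$$ and $\Phi_b^{\sigma,(2)}=\frac1b\int_0^1\varphi_b^{\sigma,(2)}(x)\,dx$, $\widetilde{\Phi}_b^{\sigma}=\frac1b\int_0^1\widetilde{\varphi}_b^{\sigma}(x)\,dx$, $\widetilde{\Phi}_{b,1}^{\sigma}=\frac1b\int_0^1\widetilde{\varphi}_{b,1}^{\sigma}(x)\,dx$,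 $\widetilde{\Phi}_{b,2}^{\sigma}=\frac1b\int_0^1\widetilde{\varphi}_{b,2}^{\sigma}(x)\,dx$. *)

theory Defs
  imports "HOL-Analysis.Analysis" "HOL-Library.Multiset" "HOL-Combinatorics.Permutations"
begin

definition discr_E :: "real \<Rightarrow> real \<Rightarrow> (real \<times> real) multiset \<Rightarrow> real" where
  "discr_E x y P =
     real (size (filter_mset (\<lambda>p. p \<in> {0..<x} \<times> {0..<y}) P)) - real (size P) * x * y"

definition L2_discrepancy :: "(real \<times> real) multiset \<Rightarrow> real" where
  "L2_discrepancy P =
     1 / real (size P) *
     sqrt (integral {0..1} (\<lambda>y. integral {0..1} (\<lambda>x. \<bar>discr_E x y P\<bar>\<^sup>2)))"

(* Permutations of {0,...,b-1} are functions on nat that permute {..<b}, hence are the identity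
   outside {..<b}. *)
definition tau :: "nat \<Rightarrow> nat \<Rightarrow> nat" where
  "tau b k = (if k < b then b - 1 - k else k)"

definition hammersley :: "nat \<Rightarrow> nat \<Rightarrow> (nat \<Rightarrow> nat \<Rightarrow> nat) \<Rightarrow> (real \<times> real) set" where
  "hammersley b n S =
     {(\<Sum>i<n. real (S (n - 1 - i) (a (n - 1 - i))) / real b ^ (i + 1),
       \<Sum>i<n. real (a i) / real b ^ (i + 1)) | a :: nat \<Rightarrow> nat. \<forall>i<n. a i < b}"

(* Each of the two sets has b^n distinct points; they may overlap, so the union is the
   sum of multisets. *)
definition sym_hammersley ::
    "nat \<Rightarrow> nat \<Rightarrow> (nat \<Rightarrow> nat \<Rightarrow> nat) \<Rightarrow> (real \<times> real) multiset" where
  "sym_hammersley b n S =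
     mset_set (hammersley b n S) + mset_set (hammersley b n (\<lambda>i. tau b \<circ> S i))"

definition count_A :: "nat \<Rightarrow> (nat \<Rightarrow> nat) \<Rightarrow> real \<Rightarrow> real \<Rightarrow> nat \<Rightarrow> nat" where
  "count_A b s u v k = card {M \<in> {1..k}. real (s (M - 1)) / real b \<in> {u..<v}}"

(* For 0 \<le> x < 1, the k with x in [(k-1)/b, k/b) is floor(b x) + 1. *)
definition phi_unit :: "nat \<Rightarrow> nat \<Rightarrow> (nat \<Rightarrow> nat) \<Rightarrow> real \<Rightarrow> real" where
  "phi_unit b h s x =
     (let k = nat \<lfloor>real b * x\<rfloor> + 1 in
      if h \<le> s (k - 1)
      then real (count_A b s 0 (real h / real b) k) - real h * x
      else (real b - real h) * x - real (count_A b s (real h / real b) 1 k))"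

definition phi :: "nat \<Rightarrow> nat \<Rightarrow> (nat \<Rightarrow> nat) \<Rightarrow> real \<Rightarrow> real" where
  "phi b h s x = phi_unit b h s (frac x)"

definition phi_sq :: "nat \<Rightarrow> (nat \<Rightarrow> nat) \<Rightarrow> real \<Rightarrow> real" where
  "phi_sq b s x = (\<Sum>h<b. (phi b h s x)\<^sup>2)"

definition phi_tilde :: "nat \<Rightarrow> (nat \<Rightarrow> nat) \<Rightarrow> real \<Rightarrow> real" where
  "phi_tilde b s x = (\<Sum>h<b. phi b h s x * phi b h (tau b \<circ> s) x)"

definition phi_tilde1 :: "nat \<Rightarrow> (nat \<Rightarrow> nat) \<Rightarrow> real \<Rightarrow> real" where
  "phi_tilde1 b s x = (\<Sum>h<b - 1. phi b (h + 1) s x * phi b h (tau b \<circ> s) x)"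

definition phi_tilde2 :: "nat \<Rightarrow> (nat \<Rightarrow> nat) \<Rightarrow> real \<Rightarrow> real" where
  "phi_tilde2 b s x = (\<Sum>h<b - 1. phi b h s x * phi b (h + 1) (tau b \<circ> s) x)"

definition Phi_sq :: "nat \<Rightarrow> (nat \<Rightarrow> nat) \<Rightarrow> real" where
  "Phi_sq b s = 1 / real b * integral {0..1} (phi_sq b s)"

definition Phi_tilde :: "nat \<Rightarrow> (nat \<Rightarrow> nat) \<Rightarrow> real" where
  "Phi_tilde b s = 1 / real b * integral {0..1} (phi_tilde b s)"

definition Phi_tilde1 :: "nat \<Rightarrow> (nat \<Rightarrow> nat) \<Rightarrow> real" where
  "Phi_tilde1 b s = 1 / real b * integral {0..1} (phi_tilde1 b s)"

definition Phi_tilde2 :: "nat \<Rightarrow> (nat \<Rightarrow> nat) \<Rightarrow> real" where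
  "Phi_tilde2 b s = 1 / real b * integral {0..1} (phi_tilde2 b s)"

definition c_const :: "nat \<Rightarrow> (nat \<Rightarrow> nat) \<Rightarrow> real" where
  "c_const b s = 2 * Phi_sq b s + Phi_tilde b s + 1 / 2 * Phi_tilde1 b s + 1 / 2 * Phi_tilde2 b s"

end

theory Submission
  imports Defs
begin

text \<open>Put \<open>N = b^n\<close>. Since \<open>\<sigma>\<close> commutes with \<open>\<tau>\<close>, the Hammersley set is centrally symmetric on the
  \<open>N \<times> N\<close> grid, and the second set is its mirror image; hence the discrepancy function \<open>D\<close> of the
  union, restricted to grid points, is odd under both reflections. Integrating the square of the
  discrepancy function cell by cell, all terms linear in \<open>D\<close> cancel, and the integral is
  \<open>(\<Sum> D\<^sup>2) / N\<^sup>2 + 25/18 + 1/N + 1/(18 N\<^sup>2)\<close>.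

  Adding a digit changes \<open>D\<close> at \<open>(l N + \<lambda>, b \<mu> + m)\<close> to \<open>D(\<lambda>, \<mu>)\<close> plus the linear interpolation in
  \<open>\<lambda> / N\<close> of the one-digit discrepancies at \<open>(l, m)\<close> and \<open>(l + 1, m)\<close>, plus a part of the increment
  \<open>D(\<lambda>, \<mu> + 1) - D(\<lambda>, \<mu>)\<close>. The interpolation term is constant in \<open>\<mu>\<close> and \<open>D\<close> has mean zero, so these
  two do not interact; the increments are controlled by pairing \<open>l\<close> with \<open>b - 1 - l\<close>. This gives an
  affine recursion for \<open>\<Sum> D\<^sup>2\<close> that no longer depends on the choice of the permutations. Finally the
  \<open>\<phi>\<close>-functions are the piecewise linear interpolations of the one-digit discrepancies, which
  identifies the constant of the recursion with \<open>c\<close>.\<close>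

section \<open>Finite sums: blocks, reflection, cyclic shift, power sums\<close>

lemma sum_block:
  fixes f :: "nat \<Rightarrow> 'a::comm_monoid_add"
  shows "sum f {c..<c + k} = (\<Sum>j<k. f (c + j))"
  using sum.shift_bounds_nat_ivl[of f 0 c k] by (simp add: lessThan_atLeast0 add.commute)

lemma sum_mult_block:
  fixes f :: "nat \<Rightarrow> 'a::comm_monoid_add"
  shows "sum f {..<n * k} = (\<Sum>i<n. \<Sum>j<k. f (i * k + j))"
  by (simp add: sum.nat_group[symmetric] sum_block)

lemma sum_split_block:
  fixes f :: "nat \<Rightarrow> 'a::comm_monoid_add"
  shows "sum f {..<n * k + m} = (\<Sum>i<n. \<Sum>j<k. f (i * k + j)) + (\<Sum>j<m. f (n * k + j))"
proof -
  have "sum f {..<n * k + m} = sum f {..<n * k} + sum f {n * k..<n * k + m}"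
    by (simp add: lessThan_atLeast0 sum.atLeastLessThan_concat)
  then show ?thesis by (simp add: sum_mult_block sum_block)
qed

lemma sum_reflect:
  fixes f :: "nat \<Rightarrow> 'a::comm_monoid_add"
  shows "(\<Sum>i<n. f (n - 1 - i)) = sum f {..<n}"
  using sum.nat_diff_reindex[of f n] by simp

lemma sum_shift_periodic:
  fixes f :: "nat \<Rightarrow> 'a::ab_group_add"
  assumes "f n = f 0"
  shows "(\<Sum>i<n. f (Suc i)) = sum f {..<n}"
  using assms sum.lessThan_Suc_shift[of f n] by simp

text \<open>Dropping \<open>i = 0\<close> and shifting turns the summand for \<open>m + 2\<close>
  into 1 plus the summand for \<open>m\<close>, so the induction goes in steps of two. This sum is a
  source of the parity terms \<open>(-1) ^ n\<close> below.\<close>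

lemma sum_sawtooth_min:
  "(\<Sum>i<n. real (min i (n - i))) = real n ^ 2 / 4 - (1 - (-1) ^ n) / 8"
proof (induction n rule: less_induct)
  case (less n)
  consider "n = 0" | "n = 1" | m where "n = Suc (Suc m)"
    by (metis One_nat_def not0_implies_Suc)
  then show ?case
  proof cases
    case 3
    have "(\<Sum>i<n. real (min i (n - i))) = (\<Sum>i<Suc m. real (min (Suc i) (n - Suc i)))"
      unfolding 3 by (subst sum.lessThan_Suc_shift) simp
    also have "\<dots> = (\<Sum>i<Suc m. 1 + real (min i (m - i)))"
      by (intro sum.cong) (auto simp: 3 min_def)
    also have "\<dots> = (\<Sum>i<m. real (min i (m - i))) + m + 1"
      by (simp add: sum.distrib)
    finally show ?thesis
      using less[of m] 3 by (simp add: field_simps power2_eq_square)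
  qed auto
qed

lemma sum_real_squares: "(\<Sum>i<n. real i ^ 2) = (real n - 1) * real n * (2 * real n - 1) / 6"
  by (induction n) (auto simp: field_simps power2_eq_square)

lemma sum_real_ids: "(\<Sum>i<n. real i) = real n * (real n - 1) / 2"
  by (induction n) (auto simp: field_simps power2_eq_square)

section \<open>Points indexed by their second coordinate\<close>

text \<open>For \<open>y < b^n\<close>, the point of the Hammersley set with second coordinate \<open>y / b^n\<close> has first
  coordinate \<open>hamm_x b S n y / b^n\<close>.\<close>

primrec hamm_x :: "nat \<Rightarrow> (nat \<Rightarrow> nat \<Rightarrow> nat) \<Rightarrow> nat \<Rightarrow> nat \<Rightarrow> nat" where
  "hamm_x b S 0 y = 0"
| "hamm_x b S (Suc n) y = hamm_x b S n (y div b) + S n (y mod b) * b ^ n"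

lemma digit_sum_Suc:
  fixes a :: "nat \<Rightarrow> nat"
  shows "(\<Sum>i<Suc n. a i * b ^ (Suc n - 1 - i)) = (\<Sum>i<n. a i * b ^ (n - 1 - i)) * b + a n"
proof -
  have "(\<Sum>i<n. a i * b ^ (n - i)) = (\<Sum>i<n. a i * b ^ (n - 1 - i) * b)"
  proof (intro sum.cong refl)
    fix i assume "i \<in> {..<n}"
    then have "n - i = Suc (n - 1 - i)" by auto
    then show "a i * b ^ (n - i) = a i * b ^ (n - 1 - i) * b" by simp
  qed
  then show ?thesis by (simp add: sum_distrib_right)
qed

text \<open>The digit \<open>a 0\<close> is the leading digit of the ordinate but enters the
  abscissa with weight 1: the order of significance is reversed.\<close>

lemma hamm_x_digits:
  fixes a :: "nat \<Rightarrow> nat"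
  assumes "\<forall>i<n. a i < b"
  shows "(\<Sum>i<n. a i * b ^ (n - 1 - i)) < b ^ n
    \<and> hamm_x b S n (\<Sum>i<n. a i * b ^ (n - 1 - i)) = (\<Sum>i<n. S i (a i) * b ^ i)"
  using assms
proof (induction n)
  case (Suc n)
  let ?v = "\<Sum>i<n. a i * b ^ (n - 1 - i)"
  have an: "a n < b" and IH: "?v < b ^ n"
    "hamm_x b S n ?v = (\<Sum>i<n. S i (a i) * b ^ i)"
    using Suc by auto
  have "?v * b + a n < (?v + 1) * b" using an by simp
  also have "\<dots> \<le> b ^ n * b" using IH(1) by (intro mult_right_mono) auto
  finally show ?case unfolding digit_sum_Suc using an IH(2) by (simp add: mult.commute)
qed simp

lemma ex_digits:
  fixes y :: nat
  assumes "y < b ^ n"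
  shows "\<exists>a. (\<forall>i<n. a i < b) \<and> (\<Sum>i<n. a i * b ^ (n - 1 - i)) = y"
  using assms
proof (induction n arbitrary: y)
  case (Suc n)
  have b: "b > 0" using Suc.prems by (cases b) auto
  have "y div b < b ^ n" using Suc.prems by (simp add: less_mult_imp_div_less mult.commute)
  from Suc.IH[OF this] obtain a where a: "\<forall>i<n. a i < b"
    "(\<Sum>i<n. a i * b ^ (n - 1 - i)) = y div b" by blast
  let ?a = "a(n := y mod b)"
  have "(\<Sum>i<n. ?a i * b ^ (n - 1 - i)) = (\<Sum>i<n. a i * b ^ (n - 1 - i))"
    by (intro sum.cong) auto
  then have "(\<Sum>i<Suc n. ?a i * b ^ (Suc n - 1 - i)) = y div b * b + y mod b"
    unfolding digit_sum_Suc a(2) by simp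
  then show ?case using a(1) b by (intro exI[of _ ?a]) auto
qed simp

text \<open>Replaces digit vectors by the single integer \<open>y\<close>, so that the set becomes
  the graph of an integer function scaled by \<open>b ^ n\<close>.\<close>

lemma hammersley_eq_image:
  assumes "b > 0"
  shows "hammersley b n S = (\<lambda>y. (real (hamm_x b S n y) / real b ^ n, real y / real b ^ n)) ` {..<b ^ n}"
proof -
  \<comment> \<open>Over the common denominator \<open>b ^ n\<close>, the weight of index
    \<open>n - 1 - i\<close> is \<open>b ^ (n - 1 - i)\<close>; reversing the order of summation
    gives the stated form.\<close>
  have scale: "(\<Sum>i<n. real (f (n - 1 - i)) / real b ^ (i + 1)) = real (\<Sum>i<n. f i * b ^ i) / real b ^ n"
    for f :: "nat \<Rightarrow> nat"
  proof -
    have "(\<Sum>i<n. real (f (n - 1 - i)) / real b ^ (i + 1))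
        = (\<Sum>i<n. real (f (n - 1 - i)) * real b ^ (n - 1 - i) / real b ^ n)"
    proof (intro sum.cong refl)
      fix i assume "i \<in> {..<n}"
      then have "n = (n - 1 - i) + (i + 1)" by auto
      then have "real b ^ n = real b ^ (n - 1 - i) * real b ^ (i + 1)" by (metis power_add)
      then show "real (f (n - 1 - i)) / real b ^ (i + 1)
          = real (f (n - 1 - i)) * real b ^ (n - 1 - i) / real b ^ n"
        using assms by simp
    qed
    also have "\<dots> = (\<Sum>i<n. real (f i) * real b ^ i / real b ^ n)"
      by (rule sum_reflect)
    finally show ?thesis by (simp add: sum_divide_distrib)
  qed
  have pt: "((\<Sum>i<n. real (S (n - 1 - i) (a (n - 1 - i))) / real b ^ (i + 1)),
        (\<Sum>i<n. real (a i) / real b ^ (i + 1)))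
      = (real (hamm_x b S n y) / real b ^ n, real y / real b ^ n)"
    if "\<forall>i<n. a i < b" "y = (\<Sum>i<n. a i * b ^ (n - 1 - i))" for a y
  proof -
    have "(\<Sum>i<n. real (a i) / real b ^ (i + 1))
        = (\<Sum>i<n. real (a (n - 1 - (n - 1 - i))) / real b ^ (i + 1))"
      by (intro sum.cong) auto
    also have "\<dots> = real (\<Sum>i<n. a (n - 1 - i) * b ^ i) / real b ^ n"
      by (rule scale)
    also have "(\<Sum>i<n. a (n - 1 - i) * b ^ i) = (\<Sum>i<n. a (n - 1 - (n - 1 - i)) * b ^ (n - 1 - i))"
      by (rule sum_reflect[symmetric])
    also have "\<dots> = y" unfolding that by (intro sum.cong) auto
    finally show ?thesis
      using scale[of "\<lambda>i. S i (a i)"] hamm_x_digits[OF that(1), of S] that(2) by simp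
  qed
  show ?thesis (is "_ = ?R")
  proof (intro equalityI subsetI)
    fix p assume "p \<in> hammersley b n S"
    then obtain a where a: "\<forall>i<n. a i < b"
      and p: "p = ((\<Sum>i<n. real (S (n - 1 - i) (a (n - 1 - i))) / real b ^ (i + 1)),
        (\<Sum>i<n. real (a i) / real b ^ (i + 1)))"
      unfolding hammersley_def by blast
    show "p \<in> ?R" unfolding p pt[OF a refl] using hamm_x_digits[OF a] by blast
  next
    fix p assume "p \<in> ?R"
    then obtain y where y: "y < b ^ n" "p = (real (hamm_x b S n y) / real b ^ n, real y / real b ^ n)"
      by auto
    from ex_digits[OF y(1)] obtain a where a: "\<forall>i<n. a i < b" "(\<Sum>i<n. a i * b ^ (n - 1 - i)) = y"
      by blast
    show "p \<in> hammersley b n S"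
      unfolding hammersley_def y(2) pt[OF a(1) a(2)[symmetric], symmetric] using a(1) by blast
  qed
qed

lemma hamm_x_less:
  assumes "\<And>i x. i < n \<Longrightarrow> x < b \<Longrightarrow> S i x < b" "b > 0" "y < b ^ n"
  shows "hamm_x b S n y < b ^ n"
  using assms
proof (induction n arbitrary: y)
  case (Suc n)
  have "y div b < b ^ n" using Suc.prems by (simp add: less_mult_imp_div_less mult.commute)
  then have "hamm_x b S n (y div b) < b ^ n" using Suc by simp
  moreover have "S n (y mod b) + 1 \<le> b" using Suc.prems by (simp add: Suc_leI)
  then have "(S n (y mod b) + 1) * b ^ n \<le> b * b ^ n" by (intro mult_right_mono) auto
  ultimately show ?case by simp
qed simp

lemma hamm_x_bij:
  assumes "\<And>i. i < n \<Longrightarrow> S i permutes {..<b}" "b > 0"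
  shows "bij_betw (hamm_x b S n) {..<b ^ n} {..<b ^ n}"
proof -
  have lt: "S i x < b" if "i < n" "x < b" for i x
    using permutes_in_image[OF assms(1)[OF that(1)], of x] that by simp
  have "inj_on (hamm_x b S n) {..<b ^ n}"
    using assms(1) lt
  proof (induction n)
    case (Suc n)
    show ?case
    proof (rule inj_onI)
      fix y z assume yz: "y \<in> {..<b ^ Suc n}" "z \<in> {..<b ^ Suc n}"
        and eq: "hamm_x b S (Suc n) y = hamm_x b S (Suc n) z"
      have q: "y div b < b ^ n" "z div b < b ^ n"
        using yz by (simp_all add: less_mult_imp_div_less mult.commute)
      have l: "hamm_x b S n (y div b) < b ^ n" "hamm_x b S n (z div b) < b ^ n"
        by (rule hamm_x_less; use q Suc.prems assms(2) in auto)+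
      \<comment> \<open>The lower part is below \<open>b ^ n\<close>, so remainder and quotient by
        \<open>b ^ n\<close> separate it from the newly added leading digit.\<close>
      have "(hamm_x b S n (y div b) + S n (y mod b) * b ^ n) mod b ^ n
          = (hamm_x b S n (z div b) + S n (z mod b) * b ^ n) mod b ^ n"
        "(hamm_x b S n (y div b) + S n (y mod b) * b ^ n) div b ^ n
          = (hamm_x b S n (z div b) + S n (z mod b) * b ^ n) div b ^ n"
        using eq by simp_all
      then have e: "hamm_x b S n (y div b) = hamm_x b S n (z div b)" "S n (y mod b) = S n (z mod b)"
        using l assms(2) by simp_all
      have "y div b = z div b" using e(1) Suc q by (auto dest: inj_onD)
      moreover have "y mod b = z mod b"
        using e(2) permutes_inj[OF Suc.prems(1)[of n]] by (auto dest: injD)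
      ultimately show "y = z" by (metis div_mult_mod_eq)
    qed
  qed (simp add: inj_on_def)
  moreover have "hamm_x b S n ` {..<b ^ n} \<subseteq> {..<b ^ n}"
    using hamm_x_less[of n b S] lt assms(2) by auto
  ultimately show ?thesis
    by (simp add: bij_betw_def endo_inj_surj)
qed

text \<open>Subtracting from \<open>b * M - 1\<close> never borrows at the last digit: that digit
  and the remaining quotient are complemented independently.\<close>

lemma reflect_digit:
  fixes b y :: nat
  assumes "y < b * M"
  shows "(b * M - 1 - y) div b = M - 1 - y div b" "(b * M - 1 - y) mod b = b - 1 - y mod b"
proof -
  have b: "b > 0" using assms by (cases b) auto
  have q: "y div b < M" using assms by (simp add: less_mult_imp_div_less mult.commute)
  have "b * M - 1 - y = (M - 1 - y div b) * b + (b - 1 - y mod b)"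
  proof -
    obtain r where r: "M = y div b + 1 + r" using q by (metis add.commute Suc_eq_plus1 less_iff_Suc_add add_Suc_right)
    have yy: "y = b * (y div b) + y mod b" by simp
    have rb: "y mod b < b" using b by simp
    define u v where "u = y div b" and "v = y mod b"
    have "b * M = b * u + b + b * r" unfolding r u_def by (simp add: algebra_simps)
    moreover have "(M - 1 - u) * b = b * r" unfolding r u_def by (simp add: algebra_simps)
    ultimately show ?thesis using yy rb unfolding u_def[symmetric] v_def[symmetric] by linarith
  qed
  moreover have "b - 1 - y mod b < b" using b by auto
  ultimately show "(b * M - 1 - y) div b = M - 1 - y div b" "(b * M - 1 - y) mod b = b - 1 - y mod b"
    by simp_all
qed

text \<open>Complementing every digit of the abscissa complements the whole number, so the second
  Hammersley set is the first one mirrored in the first coordinate.\<close>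

lemma hamm_x_tau:
  assumes "\<And>i x. i < n \<Longrightarrow> x < b \<Longrightarrow> S i x < b" "b > 0" "y < b ^ n"
  shows "hamm_x b (\<lambda>i. tau b \<circ> S i) n y = b ^ n - 1 - hamm_x b S n y"
  using assms
proof (induction n arbitrary: y)
  case (Suc n)
  have q: "y div b < b ^ n" using Suc.prems by (simp add: less_mult_imp_div_less mult.commute)
  have IH: "hamm_x b (\<lambda>i. tau b \<circ> S i) n (y div b) = b ^ n - 1 - hamm_x b S n (y div b)"
    by (rule Suc.IH; use Suc.prems q in simp)
  have l: "hamm_x b S n (y div b) < b ^ n"
    using Suc.prems(1,2) q by (auto intro!: hamm_x_less)
  have s: "S n (y mod b) < b" using Suc.prems by simp
  obtain r where r: "b = S n (y mod b) + 1 + r" using s by (metis add.commute Suc_eq_plus1 less_iff_Suc_add add_Suc_right)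
  have t: "tau b (S n (y mod b)) = r" using s r by (simp add: tau_def)
  have "b * b ^ n = S n (y mod b) * b ^ n + b ^ n + r * b ^ n"
    by (subst r) (simp add: algebra_simps)
  then show ?case using IH l t by (simp del: comp_apply add: comp_apply[of "tau b" "S n"])
qed simp

text \<open>Complementing \<open>y\<close> complements all its digits. As each \<open>S i\<close>
  commutes with \<open>tau b\<close>, all digits of the abscissa are complemented too, which is the
  central symmetry of the set.\<close>

lemma hamm_x_reflect:
  assumes "\<And>i x. i < n \<Longrightarrow> x < b \<Longrightarrow> S i x < b" "b > 0" "y < b ^ n"
    "\<And>i. i < n \<Longrightarrow> S i \<circ> tau b = tau b \<circ> S i"
  shows "hamm_x b S n (b ^ n - 1 - y) = b ^ n - 1 - hamm_x b S n y"
  using assms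
proof (induction n arbitrary: y)
  case (Suc n)
  have "y div b < b ^ n" using Suc.prems by (simp add: less_mult_imp_div_less mult.commute)
  then have IH: "hamm_x b S n (b ^ n - 1 - y div b) = b ^ n - 1 - hamm_x b S n (y div b)"
    and l: "hamm_x b S n (y div b) < b ^ n"
    using Suc hamm_x_less[of n b S] by simp_all
  have s: "S n (y mod b) < b" using Suc.prems by simp
  obtain r where r: "b = S n (y mod b) + 1 + r" using s by (metis add.commute Suc_eq_plus1 less_iff_Suc_add add_Suc_right)
  have "S n (tau b (y mod b)) = tau b (S n (y mod b))"
    using Suc.prems(4)[of n] by (metis comp_apply lessI)
  then have t: "S n (b - 1 - y mod b) = r" using s r Suc.prems by (simp add: tau_def)
  have "b * b ^ n = S n (y mod b) * b ^ n + b ^ n + r * b ^ n"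
    by (subst r) (simp add: algebra_simps)
  then show ?case using IH l t reflect_digit[of y b "b ^ n"] Suc.prems by simp
qed simp

section \<open>The local discrepancy on the grid\<close>

text \<open>The share of the point over \<open>y\<close> in the discrepancy at abscissa
  \<open>l / N\<close>. Its expected value is subtracted point by point, so the sum over
  \<open>y < m\<close> is the discrepancy of one set at the grid point
  \<open>(l / N, m / N)\<close>.\<close>

definition local_dev :: "nat \<Rightarrow> (nat \<Rightarrow> nat) \<Rightarrow> nat \<Rightarrow> nat \<Rightarrow> real" where
  "local_dev N X l y = of_bool (X y < l) - real l / real N"

text \<open>When \<open>X (N - 1 - y) = N - 1 - X y\<close>, the point over \<open>y\<close> in the mirrored set has abscissa
  \<open>X (N - 1 - y)\<close>; so \<open>sym_dev\<close> is the discrepancy function of the symmetrized set at the grid point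
  \<open>(l / N, m / N)\<close>. It is odd under \<open>l \<mapsto> N - l\<close> and under \<open>m \<mapsto> N - m\<close>.\<close>

definition sym_dev :: "nat \<Rightarrow> (nat \<Rightarrow> nat) \<Rightarrow> nat \<Rightarrow> nat \<Rightarrow> real" where
  "sym_dev N X l m = (\<Sum>y<m. local_dev N X l y + local_dev N X l (N - 1 - y))"

lemma sum_shift_reflect:
  fixes f :: "nat \<Rightarrow> 'a::ab_group_add"
  assumes "f n = f 0"
  shows "(\<Sum>i<n. f (n - i)) = sum f {..<n}"
proof -
  have "(\<Sum>i<n. f (n - i)) = (\<Sum>i<n. f (Suc (n - 1 - i)))"
    by (intro sum.cong) (auto simp: Suc_diff_Suc)
  also have "\<dots> = (\<Sum>i<n. f (Suc i))" by (rule sum_reflect)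
  finally show ?thesis using sum_shift_periodic[OF assms] by simp
qed

lemma sum_of_bool_less: "(\<Sum>y<n. of_bool (y < m)) = (of_nat (min m n) :: 'a::semiring_1)"
  by (induction n) (auto simp: min_def le_Suc_eq add.commute simp del: sum_of_bool_eq)

context
  fixes N :: nat and X :: "nat \<Rightarrow> nat"
  assumes bij: "bij_betw X {..<N} {..<N}" and N_pos: "N > 0"
begin

lemma sum_perm: "(\<Sum>y<N. f (X y)) = (\<Sum>x<N. f x)"
  by (rule sum.reindex_bij_betw[OF bij])

lemma sum_local_dev: "l \<le> N \<Longrightarrow> (\<Sum>y<N. local_dev N X l y) = 0"
  using N_pos by (simp add: local_dev_def sum_subtractf sum_perm[of "\<lambda>x. of_bool (x < l)"]
      sum_of_bool_less del: sum_of_bool_eq)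

lemma sym_dev_0: "sym_dev N X l 0 = 0"
  by (simp add: sym_dev_def)

lemma sym_dev_N: "l \<le> N \<Longrightarrow> sym_dev N X l N = 0"
  by (simp only: sym_dev_def sum.distrib sum_reflect sum_local_dev add_0)

text \<open>The increment from \<open>m\<close> to \<open>m + 1\<close> equals the one from
  \<open>N - 1 - m\<close> to \<open>N - m\<close>, and the values at 0 and \<open>N\<close> vanish.
  Moving inwards from both ends therefore gives opposite values.\<close>

lemma sym_dev_reflect_right:
  assumes "l \<le> N" "m \<le> N"
  shows "sym_dev N X l (N - m) = - sym_dev N X l m"
  using assms(2)
proof (induction m)
  case 0
  then show ?case using assms by (simp add: sym_dev_N sym_dev_0)
next
  case (Suc m)
  then have "N - m = Suc (N - Suc m)" and "N - 1 - (N - Suc m) = m" by simp_all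
  then have "sym_dev N X l (N - m) = sym_dev N X l (N - Suc m)
      + (local_dev N X l (N - Suc m) + local_dev N X l m)"
    by (simp add: sym_dev_def)
  then show ?case using Suc by (simp add: sym_dev_def)
qed

lemma sum_sym_dev_right:
  assumes "l \<le> N"
  shows "(\<Sum>m<N. sym_dev N X l m) = 0"
proof -
  have "(\<Sum>m<N. sym_dev N X l (N - m)) = (\<Sum>m<N. sym_dev N X l m)"
    by (rule sum_shift_reflect) (simp add: sym_dev_0 sym_dev_N assms)
  moreover have "(\<Sum>m<N. sym_dev N X l (N - m)) = - (\<Sum>m<N. sym_dev N X l m)"
    by (simp add: sym_dev_reflect_right assms sum_negf)
  ultimately show ?thesis by simp
qed

context
  assumes X_refl: "\<And>y. y < N \<Longrightarrow> X (N - 1 - y) = N - 1 - X y"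
begin

lemma perm_less: "y < N \<Longrightarrow> X y < N"
  using bij by (auto simp: bij_betw_def)

text \<open>By central symmetry the point over \<open>N - 1 - y\<close> lies left of
  \<open>l\<close> exactly when the point over \<open>y\<close> does not lie left of
  \<open>N - l\<close>.\<close>

lemma local_dev_reflect:
  assumes "l \<le> N" "y < N"
  shows "local_dev N X (N - l) y = - local_dev N X l (N - 1 - y)"
proof -
  have "X (N - 1 - y) < l \<longleftrightarrow> \<not> X y < N - l"
    using assms perm_less[of y] X_refl[of y] by auto
  then show ?thesis
    using assms N_pos unfolding local_dev_def by (auto simp: of_nat_diff field_simps)
qed

lemma sym_dev_reflect_left:
  assumes "l \<le> N" "m \<le> N"
  shows "sym_dev N X (N - l) m = - sym_dev N X l m"
  unfolding sym_dev_def sum_negf[symmetric]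
proof (intro sum.cong refl)
  fix y assume "y \<in> {..<m}"
  then have "y < N" "N - 1 - y < N" "N - 1 - (N - 1 - y) = y" using assms by auto
  then show "local_dev N X (N - l) y + local_dev N X (N - l) (N - 1 - y) =
      - (local_dev N X l y + local_dev N X l (N - 1 - y))"
    using assms(1) by (simp only: local_dev_reflect minus_add_distrib)
qed

lemma sym_dev_left_0:
  assumes "m \<le> N"
  shows "sym_dev N X 0 m = 0" "sym_dev N X N m = 0"
proof -
  show "sym_dev N X 0 m = 0" by (simp add: sym_dev_def local_dev_def)
  then show "sym_dev N X N m = 0" using sym_dev_reflect_left[of 0 m] assms by simp
qed

lemma sum_sym_dev_left:
  assumes "m \<le> N"
  shows "(\<Sum>l<N. sym_dev N X l m) = 0"
proof -
  have "(\<Sum>l<N. sym_dev N X (N - l) m) = (\<Sum>l<N. sym_dev N X l m)"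
    by (rule sum_shift_reflect[of "\<lambda>l. sym_dev N X l m"]) (simp add: sym_dev_left_0 assms)
  moreover have "(\<Sum>l<N. sym_dev N X (N - l) m) = - (\<Sum>l<N. sym_dev N X l m)"
    by (simp add: sym_dev_reflect_left assms sum_negf)
  ultimately show ?thesis by simp
qed

text \<open>Only the product of the two indicators needs work. Substituting \<open>x = X y\<close>,
  it counts the \<open>x\<close> with both \<open>x\<close> and \<open>N - 1 - x\<close> below
  \<open>l\<close>, a number that no longer depends on \<open>X\<close>.\<close>

lemma sum_local_dev_mult_reflect:
  assumes "l \<le> N"
  shows "(\<Sum>y<N. local_dev N X l y * local_dev N X l (N - 1 - y))
    = real l - real (min l (N - l)) - real l ^ 2 / real N"
proof -
  have *: "(\<Sum>y<N. of_bool (X y < l) * of_bool (X (N - 1 - y) < l) :: real) = real l - real (min l (N - l))"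
  proof -
    have "(\<Sum>y<N. of_bool (X y < l) * of_bool (X (N - 1 - y) < l))
        = (\<Sum>y<N. of_bool (X y < l) * of_bool (N - 1 - X y < l) :: real)"
      by (intro sum.cong) (simp_all only: X_refl lessThan_iff)
    also have "\<dots> = (\<Sum>x<N. of_bool (x < l) * of_bool (N - 1 - x < l))"
      by (rule sum_perm[of "\<lambda>x. of_bool (x < l) * of_bool (N - 1 - x < l)"])
    also have "\<dots> = (\<Sum>x<N. of_bool (x < l) - of_bool (x < min l (N - l)))"
      using assms by (intro sum.cong) (auto simp: of_bool_def)
    also have "\<dots> = real l - real (min l (N - l))"
      using assms by (simp add: sum_subtractf sum_of_bool_less del: sum_of_bool_eq min_less_iff_conj)
    finally show ?thesis .
  qed
  have s: "(\<Sum>y<N. of_bool (X y < l)) = real l"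
    using assms by (simp add: sum_perm[of "\<lambda>x. of_bool (x < l)"] sum_of_bool_less del: sum_of_bool_eq)
  then have s': "(\<Sum>y<N. of_bool (X (N - 1 - y) < l)) = real l"
    using sum_reflect[of "\<lambda>y. of_bool (X y < l) :: real" N] by simp
  have "(\<Sum>y<N. local_dev N X l y * local_dev N X l (N - 1 - y))
    = (\<Sum>y<N. of_bool (X y < l) * of_bool (X (N - 1 - y) < l)
        - real l / real N * of_bool (X y < l) - real l / real N * of_bool (X (N - 1 - y) < l)
        + (real l / real N) ^ 2)"
    by (intro sum.cong) (auto simp: local_dev_def algebra_simps power2_eq_square)
  also have "\<dots> = real l - real (min l (N - l)) - real l / real N * real l - real l / real N * real l
      + real N * (real l / real N) ^ 2"
    unfolding sum.distrib sum_subtractf sum_distrib_left[symmetric] * s s' by simp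
  also have "\<dots> = real l - real (min l (N - l)) - real l ^ 2 / real N"
    using N_pos by (simp add: power2_eq_square field_simps)
  finally show ?thesis .
qed

end

end

section \<open>From the integral to a sum over the grid\<close>

text \<open>The formula is required only in the open interval, since changing the two endpoints does
  not affect the integral. The jumps of the discrepancy function on grid lines are thus
  harmless.\<close>

lemma has_integral_quadratic:
  fixes f :: "real \<Rightarrow> real"
  assumes "u \<le> v" "\<And>x. u < x \<Longrightarrow> x < v \<Longrightarrow> f x = p + q * x + r * x ^ 2"
  shows "(f has_integral p * (v - u) + q * (v ^ 2 - u ^ 2) / 2 + r * (v ^ 3 - u ^ 3) / 3) {u..v}"
proof -
  let ?F = "\<lambda>x. p * x + q * x ^ 2 / 2 + r * x ^ 3 / 3"
  have "((\<lambda>x. p + q * x + r * x ^ 2) has_integral (?F v - ?F u)) {u..v}"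
    using assms(1)
    by (intro fundamental_theorem_of_calculus)
      (auto intro!: derivative_eq_intros simp: has_real_derivative_iff_has_vector_derivative[symmetric])
  then have "(f has_integral (?F v - ?F u)) {u..v}"
    by (rule has_integral_spike_finite[of "{u, v}", rotated 2]) (use assms(2) in auto)
  also have "?F v - ?F u = p * (v - u) + q * (v ^ 2 - u ^ 2) / 2 + r * (v ^ 3 - u ^ 3) / 3"
    by (simp add: algebra_simps diff_divide_distrib)
  finally show ?thesis .
qed

lemma has_integral_grid:
  fixes f :: "real \<Rightarrow> real"
  assumes "N > 0" "\<And>i. i < N \<Longrightarrow> (f has_integral I i) {real i / real N..real (Suc i) / real N}"
  shows "(f has_integral (\<Sum>i<N. I i)) {0..1}"
proof -
  have "(f has_integral (\<Sum>i<k. I i)) {0..real k / real N}" if "k \<le> N" for k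
    using that
  proof (induction k)
    case (Suc k)
    show ?case unfolding sum.lessThan_Suc
      by (rule has_integral_combine[of _ "real k / real N"])
        (use Suc assms in \<open>auto intro: divide_right_mono simp del: of_nat_Suc\<close>)
  qed (simp add: has_integral_refl)
  from this[of N] show ?thesis using assms(1) by simp
qed

text \<open>The coefficients may change from cell to cell. This serves the inner and the outer
  integral of the squared discrepancy, and later the products of \<open>phi\<close>
  functions.\<close>

lemma has_integral_grid_quadratic:
  fixes f :: "real \<Rightarrow> real"
  assumes "N > 0"
    "\<And>i x. i < N \<Longrightarrow> real i / real N < x \<Longrightarrow> x < real (Suc i) / real N \<Longrightarrow> f x = p i + q i * x + r i * x ^ 2"
  shows "(f has_integral (\<Sum>i<N. p i / N + q i * (2 * real i + 1) / (2 * real N ^ 2)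
    + r i * (3 * real i ^ 2 + 3 * real i + 1) / (3 * real N ^ 3))) {0..1}"
proof (rule has_integral_grid[OF assms(1)])
  fix i assume i: "i < N"
  let ?u = "real i / real N" and ?v = "real (Suc i) / real N"
  have "?u \<le> ?v" by (intro divide_right_mono) auto
  from has_integral_quadratic[OF this assms(2)[OF i]]
  have "(f has_integral p i * (?v - ?u) + q i * (?v ^ 2 - ?u ^ 2) / 2 + r i * (?v ^ 3 - ?u ^ 3) / 3) {?u..?v}" .
  moreover have "?v - ?u = 1 / real N" by (simp add: add_divide_distrib)
  moreover have "?v ^ 2 - ?u ^ 2 = (2 * real i + 1) / real N ^ 2"
    by (simp add: power_divide diff_divide_distrib[symmetric] power2_eq_square algebra_simps)
  moreover have "?v ^ 3 - ?u ^ 3 = (3 * real i ^ 2 + 3 * real i + 1) / real N ^ 3"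
    using assms(1) by (simp add: field_simps power2_eq_square power3_eq_cube)
  ultimately show "(f has_integral p i / N + q i * (2 * real i + 1) / (2 * real N ^ 2)
    + r i * (3 * real i ^ 2 + 3 * real i + 1) / (3 * real N ^ 3)) {?u..?v}"
    by (simp add: mult.commute)
qed

text \<open>The symmetrized set for an arbitrary \<open>X\<close>. When \<open>X\<close> comes from
  permutations commuting with \<open>tau b\<close>, the second summand is the Hammersley set of the
  composed permutations, see \<open>sym_hammersley_eq_sym_points\<close>.\<close>

definition sym_points :: "nat \<Rightarrow> (nat \<Rightarrow> nat) \<Rightarrow> (real \<times> real) multiset" where
  "sym_points N X = mset_set ((\<lambda>y. (real (X y) / real N, real y / real N)) ` {..<N})
     + mset_set ((\<lambda>y. (real (X (N - 1 - y)) / real N, real y / real N)) ` {..<N})"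

lemma size_filter_graph:
  assumes "N > 0"
  shows "real (size (filter_mset Q (mset_set ((\<lambda>y. (real (Z y) / real N, real y / real N)) ` {..<N}))))
    = (\<Sum>y<N. of_bool (Q (real (Z y) / real N, real y / real N)))"
proof -
  let ?f = "\<lambda>y. (real (Z y) / real N, real y / real N)"
  have inj: "inj_on ?f A" for A using assms by (auto simp: inj_on_def)
  have "size (filter_mset Q (mset_set (?f ` {..<N}))) = card {p \<in> ?f ` {..<N}. Q p}"
    by (simp add: filter_mset_mset_set)
  also have "{p \<in> ?f ` {..<N}. Q p} = ?f ` ({..<N} \<inter> {y. Q (?f y)})" by auto
  also have "card \<dots> = card ({..<N} \<inter> {y. Q (?f y)})" by (rule card_image[OF inj])
  finally show ?thesis by simp
qed

lemma size_sym_points: "N > 0 \<Longrightarrow> size (sym_points N X) = 2 * N"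
  by (simp add: sym_points_def card_image inj_on_def)

lemma grid_less_iff:
  assumes "real i / real N < x" "x < real (Suc i) / real N" "N > 0"
  shows "real k / real N < x \<longleftrightarrow> k < Suc i"
proof -
  have "real i < real N * x" "real N * x < real (Suc i)"
    using assms by (simp_all add: field_simps)
  moreover have "real k / real N < x \<longleftrightarrow> real k < real N * x" using assms(3) by (simp add: field_simps)
  ultimately show ?thesis by (cases "k < Suc i") auto
qed

text \<open>Points sit at lower left corners of cells, so throughout an open cell the count is the
  one at its upper right corner, hence the \<open>Suc\<close>. The middle term restores the area
  already subtracted in \<open>sym_dev\<close>.\<close>

lemma discr_E_sym_points:
  assumes "N > 0" "i < N" "j < N"
    and x: "real i / real N < x" "x < real (Suc i) / real N"
    and y: "real j / real N < y" "y < real (Suc j) / real N"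
  shows "discr_E x y (sym_points N X) =
    sym_dev N X (Suc i) (Suc j) + 2 * real (Suc i) * real (Suc j) / real N - 2 * real N * x * y"
proof -
  have cnt: "real (size (filter_mset (\<lambda>p. p \<in> {0..<x} \<times> {0..<y})
        (mset_set ((\<lambda>y. (real (Z y) / real N, real y / real N)) ` {..<N}))))
      = (\<Sum>y<Suc j. of_bool (Z y < Suc i))" for Z :: "nat \<Rightarrow> nat"
  proof -
    have "(\<Sum>k<N. of_bool ((real (Z k) / real N, real k / real N) \<in> {0..<x} \<times> {0..<y}) :: real)
        = (\<Sum>k<N. if k \<in> {..<Suc j} then of_bool (Z k < Suc i) else 0)"
      using grid_less_iff[OF x assms(1)] grid_less_iff[OF y assms(1)]
      by (intro sum.cong) (auto simp: of_bool_def)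
    also have "\<dots> = (\<Sum>k\<in>{..<N} \<inter> {..<Suc j}. of_bool (Z k < Suc i))"
      by (rule sum.inter_restrict[symmetric]) simp
    also have "{..<N} \<inter> {..<Suc j} = {..<Suc j}" using assms by auto
    finally show ?thesis using size_filter_graph[OF assms(1)] by simp
  qed
  have "sym_dev N X (Suc i) (Suc j) = (\<Sum>y<Suc j. of_bool (X y < Suc i))
      + (\<Sum>y<Suc j. of_bool (X (N - 1 - y) < Suc i)) - 2 * real (Suc i) * real (Suc j) / real N"
    unfolding sym_dev_def local_dev_def using assms(1)
    by (simp add: sum.distrib sum_subtractf del: sum_of_bool_eq sum.lessThan_Suc) (simp add: field_simps)
  then show ?thesis
    unfolding discr_E_def size_sym_points[OF assms(1)]
    unfolding sym_points_def filter_union_mset size_union of_nat_add cnt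
    using assms(1) by (simp add: field_simps)
qed

lemma sum_real_Suc_squares: "(\<Sum>i<n. real (Suc i) ^ 2) = real n * (real n + 1) * (2 * real n + 1) / 6"
  by (induction n) (auto simp: field_simps power2_eq_square)

lemma sum_real_Suc_odd: "(\<Sum>i<n. real (Suc i) * (2 * real i + 1)) = real n * (real n + 1) * (4 * real n - 1) / 6"
  by (induction n) (auto simp: field_simps power2_eq_square)

lemma sum_cube_differences: "(\<Sum>i<n. 3 * real i ^ 2 + 3 * real i + 1) = real n ^ 3"
  by (induction n) (auto simp: field_simps power2_eq_square power3_eq_cube)

lemma integral_discr_E_sym_points:
  assumes bij: "bij_betw X {..<N} {..<N}" and N: "N > 0"
    and X_refl: "\<And>y. y < N \<Longrightarrow> X (N - 1 - y) = N - 1 - X y"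
  shows "integral {0..1} (\<lambda>y. integral {0..1} (\<lambda>x. \<bar>discr_E x y (sym_points N X)\<bar>\<^sup>2))
    = (\<Sum>i<N. \<Sum>j<N. (sym_dev N X i j)\<^sup>2) / real N ^ 2 + 25 / 18 + 1 / real N + 1 / (18 * real N ^ 2)"
proof -
  let ?D = "\<lambda>i j. sym_dev N X (Suc i) (Suc j)"
  let ?m = "real N"
  define a where "a i j = ?D i j + 2 * real (Suc i) * real (Suc j) / ?m" for i j
  define c where "c i = 3 * real i ^ 2 + 3 * real i + 1" for i :: nat
  \<comment> \<open>\<open>a i j\<close> is the number of counted points and \<open>c i\<close> a
    difference of consecutive cubes. Integrating \<open>(a i j - 2 * N * x * y)^2\<close> over
    \<open>x\<close> leaves a quadratic in \<open>y\<close> with coefficients \<open>P\<close>,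
    \<open>Q\<close>, \<open>R\<close>.\<close>
  define P Q R where
    "P j = (\<Sum>i<N. a i j ^ 2 / ?m)" and
    "Q j = (\<Sum>i<N. - 2 * a i j * (2 * real i + 1) / ?m)" and
    "R j = (\<Sum>i<N. 4 * c i / (3 * ?m))" for j :: nat
  have inner: "integral {0..1} (\<lambda>x. \<bar>discr_E x y (sym_points N X)\<bar>\<^sup>2) = P j + Q j * y + R j * y ^ 2"
    if j: "j < N" "real j / ?m < y" "y < real (Suc j) / ?m" for j y
  proof -
    have "((\<lambda>x. \<bar>discr_E x y (sym_points N X)\<bar>\<^sup>2) has_integral
      (\<Sum>i<N. a i j ^ 2 / ?m + (- 4 * ?m * y * a i j) * (2 * real i + 1) / (2 * ?m ^ 2)
        + (4 * ?m ^ 2 * y ^ 2) * (3 * real i ^ 2 + 3 * real i + 1) / (3 * ?m ^ 3))) {0..1}"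
    proof (rule has_integral_grid_quadratic[OF N])
      fix i x assume i: "i < N" "real i / ?m < x" "x < real (Suc i) / ?m"
      show "\<bar>discr_E x y (sym_points N X)\<bar>\<^sup>2 = (a i j)\<^sup>2 + - 4 * ?m * y * a i j * x + 4 * ?m\<^sup>2 * y\<^sup>2 * x\<^sup>2"
        unfolding discr_E_sym_points[OF N i(1) j(1) i(2,3) j(2,3)] a_def[symmetric] power2_abs
        by (simp add: power2_eq_square algebra_simps)
    qed
    then have "integral {0..1} (\<lambda>x. \<bar>discr_E x y (sym_points N X)\<bar>\<^sup>2)
      = (\<Sum>i<N. a i j ^ 2 / ?m + (- 4 * ?m * y * a i j) * (2 * real i + 1) / (2 * ?m ^ 2)
        + (4 * ?m ^ 2 * y ^ 2) * (3 * real i ^ 2 + 3 * real i + 1) / (3 * ?m ^ 3))"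
      by (rule integral_unique)
    also have "\<dots> = P j + Q j * y + R j * y ^ 2"
      unfolding P_def Q_def R_def sum_distrib_right sum.distrib[symmetric] c_def
      using N by (intro sum.cong) (auto simp: field_simps power2_eq_square power3_eq_cube)
    finally show ?thesis .
  qed
  have "integral {0..1} (\<lambda>y. integral {0..1} (\<lambda>x. \<bar>discr_E x y (sym_points N X)\<bar>\<^sup>2))
    = (\<Sum>j<N. P j / ?m + Q j * (2 * real j + 1) / (2 * ?m ^ 2) + R j * c j / (3 * ?m ^ 3))"
    using has_integral_grid_quadratic[OF N inner] unfolding c_def by (rule integral_unique)
  also have "\<dots> = (\<Sum>j<N. \<Sum>i<N. a i j ^ 2 / ?m ^ 2 - a i j * (2 * real i + 1) * (2 * real j + 1) / ?m ^ 3
      + 4 * c i * c j / (9 * ?m ^ 4))"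
    unfolding P_def Q_def R_def sum_distrib_right sum.distrib[symmetric] sum_divide_distrib
    using N by (intro sum.cong) (auto simp: field_simps power2_eq_square power3_eq_cube power4_eq_xxxx)
  \<comment> \<open>The coefficient of \<open>?D i j\<close> is
    \<open>(2i+2)(2j+2) - (2i+1)(2j+1) = (2i+1) + (2j+2)\<close>. Each summand depends on one index
    only, so summing \<open>?D\<close> over the other index kills the linear part.\<close>
  also have "\<dots> = (\<Sum>j<N. \<Sum>i<N. ?D i j ^ 2 / ?m ^ 2
      + ?D i j * (2 * real i + 1) / ?m ^ 3 + ?D i j * (2 * real (Suc j)) / ?m ^ 3
      + 4 * (real (Suc i) ^ 2 * real (Suc j) ^ 2) / ?m ^ 4
      - 2 * ((real (Suc i) * (2 * real i + 1)) * (real (Suc j) * (2 * real j + 1))) / ?m ^ 4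
      + 4 * (c i * c j) / (9 * ?m ^ 4))"
    unfolding a_def
    using N by (intro sum.cong refl) (simp add: field_simps power2_eq_square power3_eq_cube power4_eq_xxxx)
  also have "\<dots> = (\<Sum>j<N. \<Sum>i<N. ?D i j ^ 2) / ?m ^ 2
      + (\<Sum>i<N. \<Sum>j<N. ?D i j * (2 * real i + 1)) / ?m ^ 3
      + (\<Sum>j<N. \<Sum>i<N. ?D i j * (2 * real (Suc j))) / ?m ^ 3
      + 4 * (\<Sum>i<N. real (Suc i) ^ 2) ^ 2 / ?m ^ 4
      - 2 * (\<Sum>i<N. real (Suc i) * (2 * real i + 1)) ^ 2 / ?m ^ 4
      + 4 * (\<Sum>i<N. c i) ^ 2 / (9 * ?m ^ 4)"
    unfolding power2_eq_square[of "sum _ _"] sum_product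
    by (simp only: sum.distrib sum_subtractf sum_distrib_left sum_divide_distrib
        sum.swap[of "\<lambda>i j. ?D i j * (2 * real i + 1) / ?m ^ 3"]
        sum.swap[of "\<lambda>i j. 4 * (real (Suc i) ^ 2 * real (Suc j) ^ 2) / ?m ^ 4"])
      (simp add: mult_ac)
  also have "(\<Sum>i<N. \<Sum>j<N. ?D i j * (2 * real i + 1)) = 0"
  proof -
    have "(\<Sum>j<N. ?D i j) = 0" if "i < N" for i
      using that sum_shift_periodic[of "sym_dev N X (Suc i)" N] sum_sym_dev_right[OF bij N, of "Suc i"]
      by (simp add: sym_dev_N[OF bij N] sym_dev_0[OF bij N])
    then show ?thesis by (simp add: sum_distrib_right[symmetric])
  qed
  also have "(\<Sum>j<N. \<Sum>i<N. ?D i j * (2 * real (Suc j))) = 0"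
  proof -
    have "(\<Sum>i<N. ?D i j) = 0" if "j < N" for j
      using that sum_shift_periodic[of "\<lambda>l. sym_dev N X l (Suc j)" N]
        sum_sym_dev_left[OF bij N X_refl, of "Suc j"]
      by (simp add: sym_dev_left_0[OF bij N X_refl])
    then show ?thesis by (simp add: sum_distrib_right[symmetric])
  qed
  \<comment> \<open>\<open>sym_dev\<close> vanishes on the border of the grid, so the sum over upper
    right corners is a cyclic shift of the sum over lower left ones.\<close>
  also have "(\<Sum>j<N. \<Sum>i<N. ?D i j ^ 2) = (\<Sum>i<N. \<Sum>j<N. (sym_dev N X i j)\<^sup>2)"
  proof -
    have "(\<Sum>j<N. \<Sum>i<N. ?D i j ^ 2) = (\<Sum>j<N. \<Sum>i<N. (sym_dev N X i (Suc j))\<^sup>2)"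
      by (intro sum.cong refl sum_shift_periodic[of "\<lambda>l. (sym_dev N X l (Suc _))\<^sup>2" N])
        (simp add: sym_dev_left_0[OF bij N X_refl])
    also have "\<dots> = (\<Sum>i<N. \<Sum>j<N. (sym_dev N X i (Suc j))\<^sup>2)" by (rule sum.swap)
    also have "\<dots> = (\<Sum>i<N. \<Sum>j<N. (sym_dev N X i j)\<^sup>2)"
      by (intro sum.cong refl sum_shift_periodic[of "\<lambda>m. (sym_dev N X _ m)\<^sup>2" N])
        (simp add: sym_dev_N[OF bij N] sym_dev_0[OF bij N])
    finally show ?thesis .
  qed
  also have "(\<Sum>i<N. c i) = ?m ^ 3" unfolding c_def by (rule sum_cube_differences)
  finally have "integral {0..1} (\<lambda>y. integral {0..1} (\<lambda>x. \<bar>discr_E x y (sym_points N X)\<bar>\<^sup>2))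
      = (\<Sum>i<N. \<Sum>j<N. (sym_dev N X i j)\<^sup>2) / ?m ^ 2
        + (4 * (?m * (?m + 1) * (2 * ?m + 1) / 6) ^ 2 / ?m ^ 4
          - 2 * (?m * (?m + 1) * (4 * ?m - 1) / 6) ^ 2 / ?m ^ 4 + 4 * (?m ^ 3) ^ 2 / (9 * ?m ^ 4))"
    unfolding sum_real_Suc_squares sum_real_Suc_odd by simp
  also have "4 * (?m * (?m + 1) * (2 * ?m + 1) / 6) ^ 2 / ?m ^ 4
      - 2 * (?m * (?m + 1) * (4 * ?m - 1) / 6) ^ 2 / ?m ^ 4 + 4 * (?m ^ 3) ^ 2 / (9 * ?m ^ 4)
    = 25 / 18 + 1 / ?m + 1 / (18 * ?m ^ 2)"
  proof -
    have "m \<noteq> 0 \<Longrightarrow> 4 * (m * (m + 1) * (2 * m + 1) / 6) ^ 2 / m ^ 4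
      - 2 * (m * (m + 1) * (4 * m - 1) / 6) ^ 2 / m ^ 4 + 4 * (m ^ 3) ^ 2 / (9 * m ^ 4)
      = 25 / 18 + 1 / m + 1 / (18 * m ^ 2)" for m :: real
      by (simp add: power2_eq_square power3_eq_cube power4_eq_xxxx divide_simps) (simp add: algebra_simps)
    then show ?thesis using N by simp
  qed
  finally show ?thesis by simp
qed

section \<open>Adding a digit\<close>

text \<open>Cyclic summation by parts: it trades products of neighbouring values for products of
  increments.\<close>

lemma sum_diff_mult_periodic:
  fixes u v :: "nat \<Rightarrow> 'a::comm_ring_1"
  assumes "u n = u 0" "v n = v 0"
  shows "(\<Sum>l<n. (u (Suc l) - u l) * (v (Suc l) - v l))
    = 2 * (\<Sum>l<n. u l * v l) - (\<Sum>l<n. u (Suc l) * v l + u l * v (Suc l))"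
proof -
  have "(\<Sum>l<n. u (Suc l) * v (Suc l)) = (\<Sum>l<n. u l * v l)"
    by (rule sum_shift_periodic[of "\<lambda>l. u l * v l"]) (simp add: assms)
  then show ?thesis by (simp add: algebra_simps sum.distrib sum_subtractf)
qed

text \<open>The cross terms of \<open>D\<close> with \<open>p\<close> and \<open>q\<close> are not known separately, but those with \<open>p + q\<close>
  telescope, because \<open>2 * D y * (p y + q y) = (D (y + 1))\<^sup>2 - (D y)\<^sup>2 - (p y + q y)\<^sup>2\<close>.\<close>

lemma two_value_squares_sum:
  fixes D :: "nat \<Rightarrow> real" and p q :: "nat \<Rightarrow> real"
  assumes step: "\<And>y. D (Suc y) = D y + (p y + q y)" and "D n = D 0"
    and h: "h \<in> {0, 1}" "k \<in> {0, 1}"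
  shows "(\<Sum>y<n. (D y + (h * p y + k * q y))\<^sup>2 + (D y + (k * p y + h * q y))\<^sup>2)
    = 2 * (\<Sum>y<n. (D y)\<^sup>2) - 2 * (h - k)\<^sup>2 * (\<Sum>y<n. p y * q y)"
proof -
  have s: "(\<Sum>y<n. (D (Suc y))\<^sup>2) = (\<Sum>y<n. (D y)\<^sup>2)"
    by (rule sum_shift_periodic[of "\<lambda>y. (D y)\<^sup>2"]) (simp add: assms)
  consider "h = k" "h = 0" | "h = k" "h = 1" | "(h - k)\<^sup>2 = 1" "h = 1 \<and> k = 0 \<or> h = 0 \<and> k = 1"
    using h by auto
  then show ?thesis
  proof cases
    case 2
    then show ?thesis using s by (simp add: step sum_distrib_left[symmetric])
  next
    case 3
    then have "(D y + (h * p y + k * q y))\<^sup>2 + (D y + (k * p y + h * q y))\<^sup>2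
        = (D y)\<^sup>2 + (D (Suc y))\<^sup>2 - 2 * (p y * q y)" for y
      by (auto simp: step power2_eq_square algebra_simps)
    then show ?thesis using 3 s by (simp add: sum.distrib sum_subtractf sum_distrib_left)
  qed (simp add: sum_distrib_left)
qed

text \<open>For a permutation this is the indicator that the digit \<open>l\<close> occurs among the
  first \<open>m\<close> values. Up to \<open>m / b\<close> it is the increment in \<open>l\<close>
  of the partial sums of \<open>local_dev\<close>, see \<open>partial_dev_Suc_left\<close>.\<close>

definition hits :: "(nat \<Rightarrow> nat) \<Rightarrow> nat \<Rightarrow> nat \<Rightarrow> real" where
  "hits s l m = (\<Sum>a<m. of_bool (s a = l))"

text \<open>For a permutation \<open>s\<close>, the summand is 1 if exactly one of the digits \<open>l\<close> and \<open>b - 1 - l\<close> is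
  among \<open>s 0, \<dots>, s (m - 1)\<close>, and 0 otherwise.\<close>

definition mirror_mismatch :: "nat \<Rightarrow> (nat \<Rightarrow> nat) \<Rightarrow> real" where
  "mirror_mismatch b s = (\<Sum>m<b. \<Sum>l<b. (hits s l m - hits s (b - 1 - l) m)\<^sup>2)"

lemma local_dev_Suc_left: "local_dev b s (Suc l) a - local_dev b s l a = of_bool (s a = l) - 1 / real b"
  by (auto simp: local_dev_def of_bool_def add_divide_distrib)

lemma partial_dev_Suc_left:
  "(\<Sum>a<m. local_dev b s (Suc l) a) - (\<Sum>a<m. local_dev b s l a) = hits s l m - real m / real b"
  unfolding sum_subtractf[symmetric] local_dev_Suc_left hits_def by (simp only: sum_subtractf) simp

context
  fixes b :: nat and s :: "nat \<Rightarrow> nat"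
  assumes bij: "bij_betw s {..<b} {..<b}" and b_pos: "b > 0"
    and s_refl: "\<And>y. y < b \<Longrightarrow> s (b - 1 - y) = b - 1 - s y"
begin

lemma s_eq_iff: "y < b \<Longrightarrow> z < b \<Longrightarrow> s y = s z \<longleftrightarrow> y = z"
  using bij by (auto simp: bij_betw_def inj_on_def)

lemma hits_s: "a < b \<Longrightarrow> m \<le> b \<Longrightarrow> hits s (s a) m = of_bool (a < m)"
proof -
  assume "a < b" "m \<le> b"
  then have "hits s (s a) m = (\<Sum>x<m. of_bool (x = a))"
    unfolding hits_def by (intro sum.cong refl) (simp add: s_eq_iff)
  then show ?thesis by (simp add: of_bool_def)
qed

lemma sum_over_s: "(\<Sum>l<b. f l) = (\<Sum>a<b. f (s a))"
  by (rule sum.reindex_bij_betw[OF bij, symmetric])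

lemma hits_01:
  assumes "l < b" "m \<le> b"
  shows "hits s l m \<in> {0, 1}"
proof -
  obtain a where "a < b" "l = s a" using assms bij by (auto simp: bij_betw_def image_iff set_eq_iff)
  then show ?thesis using assms by (simp add: hits_s)
qed

text \<open>Central symmetry: reading the digits from the end exchanges \<open>l\<close> with
  \<open>b - 1 - l\<close>.\<close>

lemma hits_reflect:
  assumes "l < b" "m \<le> b"
  shows "(\<Sum>a<m. of_bool (s (b - 1 - a) = l)) = hits s (b - 1 - l) m"
  unfolding hits_def
proof (intro sum.cong refl)
  fix a assume "a \<in> {..<m}"
  then have "a < b" using assms by simp
  then show "(of_bool (s (b - 1 - a) = l) :: real) = of_bool (s a = b - 1 - l)"
    using s_refl[of a] perm_less[OF bij b_pos s_refl, of a] assms by (auto simp: of_bool_def)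
qed

lemma sum_hits: "m \<le> b \<Longrightarrow> (\<Sum>l<b. hits s l m) = real m"
  by (simp add: sum_over_s[of "\<lambda>l. hits s l m"] hits_s sum_of_bool_less del: sum_of_bool_eq)

text \<open>For fixed \<open>m\<close>, this is the variance sum of 0/1 values of which exactly
  \<open>m\<close> are 1.\<close>

lemma sum_hits_dev_sq:
  "(\<Sum>m<b. \<Sum>l<b. (hits s l m - real m / real b)\<^sup>2) = (real b ^ 2 - 1) / 6"
proof -
  have "(\<Sum>l<b. (hits s l m - real m / real b)\<^sup>2) = real m - real m ^ 2 / real b" if "m < b" for m
  proof -
    have sq: "(hits s l m)\<^sup>2 = hits s l m" if "l < b" for l
      using hits_01[OF that, of m] \<open>m < b\<close> by auto
    have "(\<Sum>l<b. (hits s l m - real m / real b)\<^sup>2)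
        = (\<Sum>l<b. hits s l m - 2 * real m / real b * hits s l m + (real m / real b)\<^sup>2)"
      by (intro sum.cong refl) (simp add: power2_diff sq)
    also have "\<dots> = real m - 2 * real m / real b * real m + real b * (real m / real b)\<^sup>2"
      using that by (simp add: sum.distrib sum_subtractf sum_distrib_left[symmetric] sum_hits
          del: times_divide_eq_left times_divide_eq_right)
    finally show ?thesis using b_pos by (simp add: field_simps power2_eq_square)
  qed
  then have "(\<Sum>m<b. \<Sum>l<b. (hits s l m - real m / real b)\<^sup>2) = (\<Sum>m<b. real m - real m ^ 2 / real b)"
    by (intro sum.cong) auto
  also have "\<dots> = real b * (real b - 1) / 2 - (real b - 1) * real b * (2 * real b - 1) / 6 / real b"
    by (simp only: sum_subtractf sum_divide_distrib[symmetric] sum_real_ids sum_real_squares)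
  also have "\<dots> = (real b ^ 2 - 1) / 6"
    using b_pos by (simp add: field_simps power2_eq_square)
  finally show ?thesis .
qed

text \<open>Substituting \<open>l = s a\<close> removes the permutation, so the value depends on
  \<open>b\<close> alone. With \<open>c = b - 1\<close>, the digits at \<open>a\<close> and
  \<open>c - a\<close> disagree exactly for \<open>m\<close> above the smaller and up to the larger
  of these positions, which is \<open>c - 2 * min a (c - a)\<close> values.\<close>

lemma mirror_mismatch_eq:
  "mirror_mismatch b s = (real b ^ 2 - 1) / 2 + (1 + (-1) ^ b) / 4"
proof -
  obtain c where c: "b = Suc c" using b_pos by (cases b) auto
  have "mirror_mismatch b s = (\<Sum>m<b. \<Sum>a<b. (of_bool (a < m) - of_bool (b - 1 - a < m))\<^sup>2)"
    unfolding mirror_mismatch_def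
  proof (rule sum.cong[OF refl])
    fix m assume m: "m \<in> {..<b}"
    have "(\<Sum>l<b. (hits s l m - hits s (b - 1 - l) m)\<^sup>2)
        = (\<Sum>a<b. (hits s (s a) m - hits s (b - 1 - s a) m)\<^sup>2)"
      by (rule sum_over_s)
    also have "\<dots> = (\<Sum>a<b. (of_bool (a < m) - of_bool (b - 1 - a < m))\<^sup>2)"
    proof (intro sum.cong refl)
      fix a assume "a \<in> {..<b}"
      then have "hits s (b - 1 - s a) m = hits s (s (b - 1 - a)) m" "a < b" by (simp_all only: s_refl lessThan_iff)
      then show "(hits s (s a) m - hits s (b - 1 - s a) m)\<^sup>2 = (of_bool (a < m) - of_bool (b - 1 - a < m))\<^sup>2"
        using m by (simp only: hits_s[of "b - 1 - a" m] hits_s[of a m]) (simp add: hits_s)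
    qed
    finally show "(\<Sum>l<b. (hits s l m - hits s (b - 1 - l) m)\<^sup>2)
      = (\<Sum>a<b. (of_bool (a < m) - of_bool (b - 1 - a < m))\<^sup>2)" .
  qed
  also have "\<dots> = (\<Sum>a<b. \<Sum>m<b. (of_bool (a < m) - of_bool (b - 1 - a < m))\<^sup>2)"
    by (rule sum.swap)
  also have "\<dots> = (\<Sum>a<b. real c - 2 * real (min a (c - a)))"
  proof (intro sum.cong refl)
    fix a assume "a \<in> {..<b}"
    then have a: "a \<le> c" by (simp add: c)
    have "(\<Sum>m<b. (of_bool (a < m) - of_bool (b - 1 - a < m))\<^sup>2)
        = (\<Sum>m<b. of_bool (m < Suc (max a (c - a))) - of_bool (m < Suc (min a (c - a))) :: real)"
      by (intro sum.cong refl) (auto simp: of_bool_def c)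
    also have "\<dots> = real (Suc (max a (c - a))) - real (Suc (min a (c - a)))"
      using a by (simp add: sum_subtractf sum_of_bool_less c min_def del: sum_of_bool_eq sum.lessThan_Suc)
    finally show "(\<Sum>m<b. (of_bool (a < m) - of_bool (b - 1 - a < m))\<^sup>2) = real c - 2 * real (min a (c - a))"
      using a by (auto simp: min_def max_def of_nat_diff)
  qed
  also have "\<dots> = real b * real c - 2 * (\<Sum>a<c. real (min a (c - a)))"
    by (simp add: c sum_subtractf sum_distrib_left[symmetric])
  finally show ?thesis unfolding sum_sawtooth_min c by (simp add: field_simps power2_eq_square)
qed

text \<open>Polarization: the mismatch is the squared distance between the deviations and their
  mirror images, and both have the same square sum.\<close>

lemma sum_hits_dev_mirror:
  "(\<Sum>m<b. \<Sum>l<b. (hits s l m - real m / real b) * (hits s (b - 1 - l) m - real m / real b))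
    = (real b ^ 2 - 1) / 6 - mirror_mismatch b s / 2"
proof -
  let ?d = "\<lambda>l m. hits s l m - real m / real b"
  have "mirror_mismatch b s = (\<Sum>m<b. (\<Sum>l<b. (?d l m)\<^sup>2) + (\<Sum>l<b. (?d (b - 1 - l) m)\<^sup>2)
      - 2 * (\<Sum>l<b. ?d l m * ?d (b - 1 - l) m))"
    unfolding mirror_mismatch_def sum_distrib_left sum.distrib[symmetric] sum_subtractf[symmetric]
    by (intro sum.cong refl) (simp add: power2_eq_square algebra_simps)
  also have "\<dots> = 2 * (\<Sum>m<b. \<Sum>l<b. (?d l m)\<^sup>2) - 2 * (\<Sum>m<b. \<Sum>l<b. ?d l m * ?d (b - 1 - l) m)"
    using sum_reflect[of "\<lambda>l. (?d l _)\<^sup>2" b]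
    by (simp add: sum.distrib sum_subtractf sum_distrib_left)
  finally show ?thesis unfolding sum_hits_dev_sq by linarith
qed

lemma partial_dev_reflect_Suc_left:
  assumes "l < b" "m \<le> b"
  shows "(\<Sum>a<m. local_dev b s (Suc l) (b - 1 - a)) - (\<Sum>a<m. local_dev b s l (b - 1 - a))
    = hits s (b - 1 - l) m - real m / real b"
  unfolding sum_subtractf[symmetric] local_dev_Suc_left hits_reflect[OF assms, symmetric]
  by (simp only: sum_subtractf) simp

lemma hits_all: "l < b \<Longrightarrow> hits s l b = 1"
proof -
  assume "l < b"
  then obtain a where "a < b" "l = s a" using bij by (auto simp: bij_betw_def image_iff set_eq_iff)
  then show ?thesis by (simp add: hits_s)
qed

end

text \<open>The new digit leads the abscissa, so the comparison is lexicographic. If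
  \<open>s a = l\<close>, the interpolation counts the point with weight \<open>la / N\<close>, and
  the last term corrects this to the true indicator.\<close>

lemma local_dev_step:
  fixes s X :: "nat \<Rightarrow> nat"
  assumes "b > 0" "N > 0" "X i < N" "la < N" "a < b"
  shows "local_dev (b * N) (\<lambda>y. X (y div b) + s (y mod b) * N) (l * N + la) (i * b + a)
    = (1 - real la / real N) * local_dev b s l a + real la / real N * local_dev b s (Suc l) a
      + of_bool (s a = l) * local_dev N X la i"
proof -
  have "(X i + s a * N < l * N + la) \<longleftrightarrow> s a < l \<or> s a = l \<and> X i < la"
  proof (cases "s a" l rule: linorder_cases)
    case less
    then have "Suc (s a) * N \<le> l * N" by (intro mult_right_mono) auto
    then show ?thesis using less assms by auto
  next
    case greater
    then have "Suc l * N \<le> s a * N" by (intro mult_right_mono) auto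
    then show ?thesis using greater assms by auto
  qed auto
  then show ?thesis using assms
    unfolding local_dev_def by (auto simp: of_bool_def field_simps)
qed

section \<open>The recursion from \<open>N\<close> to \<open>b * N\<close> grid lines\<close>

context
  fixes b :: nat and s :: "nat \<Rightarrow> nat" and N :: nat and X :: "nat \<Rightarrow> nat"
  assumes s_bij: "bij_betw s {..<b} {..<b}" and b_pos: "b > 0"
    and s_refl: "\<And>y. y < b \<Longrightarrow> s (b - 1 - y) = b - 1 - s y"
    and X_bij: "bij_betw X {..<N} {..<N}" and N_pos: "N > 0"
    and X_refl: "\<And>y. y < N \<Longrightarrow> X (N - 1 - y) = N - 1 - X y"
begin

abbreviation (input) X' where "X' \<equiv> \<lambda>y. X (y div b) + s (y mod b) * N"

lemma sym_dev_step:
  assumes "l < b" "la < N" "mu < N" "m < b"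
  shows "sym_dev (b * N) X' (l * N + la) (mu * b + m) = sym_dev N X la mu
    + ((1 - real la / real N) * sym_dev b s l m + real la / real N * sym_dev b s (Suc l) m)
    + (hits s l m * local_dev N X la mu + hits s (b - 1 - l) m * local_dev N X la (N - 1 - mu))"
proof -
  let ?t = "real la / real N"
  let ?e = "\<lambda>y. local_dev (b * N) X' (l * N + la) y + local_dev (b * N) X' (l * N + la) (b * N - 1 - y)"
  let ?E = "\<lambda>l a. local_dev b s l a + local_dev b s l (b - 1 - a)"
  have X_lt: "X i < N" if "i < N" for i using X_bij that by (auto simp: bij_betw_def)
  have e: "?e (i * b + a) = (1 - ?t) * ?E l a + ?t * ?E (Suc l) a
      + (of_bool (s a = l) * local_dev N X la i + of_bool (s (b - 1 - a) = l) * local_dev N X la (N - 1 - i))"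
    if "i < N" "a < b" for i a
  proof -
    have "Suc i * b \<le> N * b" using that by (intro mult_right_mono) auto
    then have lt: "i * b + a < b * N" using that by (simp add: mult.commute)
    have r: "b * N - 1 - (i * b + a) = (N - 1 - i) * b + (b - 1 - a)"
      using reflect_digit[OF lt] that div_mult_mod_eq[of "b * N - 1 - (i * b + a)" b] by simp
    have *: "N - 1 - i < N" "b - 1 - a < b" using N_pos b_pos by auto
    show ?thesis
      unfolding r local_dev_step[where X = X and s = s, OF b_pos N_pos X_lt[OF that(1)] assms(2) that(2)]
        local_dev_step[where X = X and s = s, OF b_pos N_pos X_lt[OF *(1)] assms(2) *(2)]
      by (simp only: algebra_simps)
  qed
  have S: "(\<Sum>a<k. ?e (i * b + a)) = (1 - ?t) * sym_dev b s l k + ?t * sym_dev b s (Suc l) k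
      + (hits s l k * local_dev N X la i + hits s (b - 1 - l) k * local_dev N X la (N - 1 - i))"
    if "i < N" "k \<le> b" for i k
  proof -
    have "(\<Sum>a<k. ?e (i * b + a)) = (\<Sum>a<k. (1 - ?t) * ?E l a + ?t * ?E (Suc l) a
      + (of_bool (s a = l) * local_dev N X la i + of_bool (s (b - 1 - a) = l) * local_dev N X la (N - 1 - i)))"
      using that by (intro sum.cong refl e) auto
    also have "\<dots> = (1 - ?t) * (\<Sum>a<k. ?E l a) + ?t * (\<Sum>a<k. ?E (Suc l) a)
      + ((\<Sum>a<k. of_bool (s a = l)) * local_dev N X la i
        + (\<Sum>a<k. of_bool (s (b - 1 - a) = l)) * local_dev N X la (N - 1 - i))"
      by (simp only: sum.distrib sum_distrib_left sum_distrib_right distrib_left)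
    finally show ?thesis
      by (simp only: hits_reflect[OF s_bij b_pos s_refl assms(1) that(2)] sym_dev_def hits_def)
  qed
  \<comment> \<open>Over a complete block the one-digit discrepancies vanish and both hit counts are
    1, so complete blocks contribute the increments of \<open>sym_dev N X la\<close>.\<close>
  have full: "(\<Sum>a<b. ?e (i * b + a)) = local_dev N X la i + local_dev N X la (N - 1 - i)" if "i < N" for i
    unfolding S[OF that order_refl]
    using assms by (simp add: sym_dev_N[OF s_bij b_pos] hits_all[OF s_bij b_pos s_refl])
  have "sym_dev (b * N) X' (l * N + la) (mu * b + m)
      = (\<Sum>i<mu. \<Sum>a<b. ?e (i * b + a)) + (\<Sum>a<m. ?e (mu * b + a))"
    unfolding sym_dev_def by (rule sum_split_block)
  also have "(\<Sum>i<mu. \<Sum>a<b. ?e (i * b + a)) = sym_dev N X la mu"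
    unfolding sym_dev_def using assms by (intro sum.cong refl full) auto
  also have "(\<Sum>a<m. ?e (mu * b + a)) = (1 - ?t) * sym_dev b s l m + ?t * sym_dev b s (Suc l) m
      + (hits s l m * local_dev N X la mu + hits s (b - 1 - l) m * local_dev N X la (N - 1 - mu))"
    by (rule S) (use assms in auto)
  finally show ?thesis by simp
qed

lemma sum_sq_fixed:
  assumes "la < N" "m < b"
  shows "(\<Sum>l<b. \<Sum>mu<N. (sym_dev N X la mu + w l
      + (hits s l m * local_dev N X la mu + hits s (b - 1 - l) m * local_dev N X la (N - 1 - mu)))\<^sup>2)
    = real b * (\<Sum>mu<N. (sym_dev N X la mu)\<^sup>2)
      - (\<Sum>l<b. (hits s l m - hits s (b - 1 - l) m)\<^sup>2) * (\<Sum>mu<N. local_dev N X la mu * local_dev N X la (N - 1 - mu))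
      + real N * (\<Sum>l<b. (w l)\<^sup>2)"
proof -
  let ?D = "sym_dev N X la" and ?p = "local_dev N X la" and ?q = "\<lambda>mu. local_dev N X la (N - 1 - mu)"
  let ?h = "\<lambda>l. hits s l m"
  define A where "A l = (\<Sum>mu<N. (?D mu + (?h l * ?p mu + ?h (b - 1 - l) * ?q mu))\<^sup>2)" for l
  have z: "(\<Sum>mu<N. ?p mu) = 0" "(\<Sum>mu<N. ?q mu) = 0" "(\<Sum>mu<N. ?D mu) = 0"
    using assms(1) sum_reflect[of ?p N]
    by (simp_all add: sum_local_dev[OF X_bij N_pos] sum_sym_dev_right[OF X_bij N_pos])
  \<comment> \<open>\<open>?D\<close>, \<open>?p\<close> and \<open>?q\<close> each sum to zero over
    \<open>mu\<close>, so all their products with \<open>w l\<close> drop out.\<close>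
  have 1: "(\<Sum>mu<N. (?D mu + w l + (?h l * ?p mu + ?h (b - 1 - l) * ?q mu))\<^sup>2) = A l + real N * (w l)\<^sup>2" for l
  proof -
    have "(\<Sum>mu<N. (?D mu + w l + (?h l * ?p mu + ?h (b - 1 - l) * ?q mu))\<^sup>2)
      = (\<Sum>mu<N. (?D mu + (?h l * ?p mu + ?h (b - 1 - l) * ?q mu))\<^sup>2 + (w l)\<^sup>2
        + (2 * w l) * ?D mu + (2 * w l * ?h l) * ?p mu + (2 * w l * ?h (b - 1 - l)) * ?q mu)"
      by (intro sum.cong refl) (simp add: power2_eq_square algebra_simps)
    also have "\<dots> = A l + real N * (w l)\<^sup>2"
      unfolding sum.distrib sum_distrib_left[symmetric] z A_def by simp
    finally show ?thesis .
  qed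
  \<comment> \<open>A single \<open>A l\<close> is not accessible. Adding
    \<open>A (b - 1 - l)\<close> exchanges the coefficients of \<open>?p\<close> and
    \<open>?q\<close>, the situation of \<open>two_value_squares_sum\<close>.\<close>
  have "2 * (\<Sum>l<b. A l) = (\<Sum>l<b. A l) + (\<Sum>l<b. A (b - 1 - l))"
    by (subst sum_reflect) simp
  also have "\<dots> = (\<Sum>l<b. A l + A (b - 1 - l))" by (rule sum.distrib[symmetric])
  also have "\<dots> = (\<Sum>l<b. 2 * (\<Sum>mu<N. (?D mu)\<^sup>2) - 2 * (?h l - ?h (b - 1 - l))\<^sup>2 * (\<Sum>mu<N. ?p mu * ?q mu))"
  proof (intro sum.cong refl)
    fix l assume "l \<in> {..<b}"
    then have l: "l < b" "b - 1 - l < b" "b - 1 - (b - 1 - l) = l" by auto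
    show "A l + A (b - 1 - l) = 2 * (\<Sum>mu<N. (?D mu)\<^sup>2) - 2 * (?h l - ?h (b - 1 - l))\<^sup>2 * (\<Sum>mu<N. ?p mu * ?q mu)"
      unfolding A_def sum.distrib[symmetric] l(3)
    proof (rule two_value_squares_sum)
      show "?D (Suc y) = ?D y + (?p y + ?q y)" for y by (simp add: sym_dev_def)
      show "?D N = ?D 0" using assms by (simp add: sym_dev_N[OF X_bij N_pos] sym_dev_0[OF X_bij N_pos])
      show "?h l \<in> {0, 1}" "?h (b - 1 - l) \<in> {0, 1}"
        by (rule hits_01[OF s_bij b_pos s_refl]; use l assms in simp)+
    qed
  qed
  also have "\<dots> = 2 * (real b * (\<Sum>mu<N. (?D mu)\<^sup>2)
      - (\<Sum>l<b. (?h l - ?h (b - 1 - l))\<^sup>2) * (\<Sum>mu<N. ?p mu * ?q mu))"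
    by (simp add: sum_subtractf sum_distrib_left sum_distrib_right algebra_simps)
  finally have "(\<Sum>l<b. A l) = real b * (\<Sum>mu<N. (?D mu)\<^sup>2)
      - (\<Sum>l<b. (?h l - ?h (b - 1 - l))\<^sup>2) * (\<Sum>mu<N. ?p mu * ?q mu)" by simp
  then show ?thesis unfolding 1 by (simp add: sum.distrib sum_distrib_left)
qed

lemma sum_sq_interpolation:
  fixes u v :: real
  shows "(\<Sum>la<N. ((1 - real la / real N) * u + real la / real N * v)\<^sup>2)
    = u\<^sup>2 * ((real N + 1) * (2 * real N + 1) / (6 * real N))
      + u * v * ((real N ^ 2 - 1) / (3 * real N))
      + v\<^sup>2 * ((real N - 1) * (2 * real N - 1) / (6 * real N))"
proof -
  have "(\<Sum>la<N. ((1 - real la / real N) * u + real la / real N * v)\<^sup>2)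
    = (\<Sum>la<N. u\<^sup>2 + (2 * u * v - 2 * u\<^sup>2) / real N * real la + (u - v)\<^sup>2 / real N ^ 2 * real la ^ 2)"
    using N_pos by (intro sum.cong refl) (simp add: field_simps power2_eq_square)
  also have "\<dots> = real N * u\<^sup>2 + (2 * u * v - 2 * u\<^sup>2) / real N * (real N * (real N - 1) / 2)
      + (u - v)\<^sup>2 / real N ^ 2 * ((real N - 1) * real N * (2 * real N - 1) / 6)"
    unfolding sum.distrib sum_distrib_left[symmetric] sum_real_ids sum_real_squares by simp
  finally show ?thesis using N_pos by (simp add: field_simps power2_eq_square)
qed

text \<open>\<open>X\<close> enters the right side only through its own square sum, so the recursion
  closes on this one number.\<close>

lemma sum_sym_dev_sq_step:
  "(\<Sum>i<b * N. \<Sum>j<b * N. (sym_dev (b * N) X' i j)\<^sup>2)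
    = real b ^ 2 * (\<Sum>i<N. \<Sum>j<N. (sym_dev N X i j)\<^sup>2)
      + mirror_mismatch b s * ((real N ^ 2 + 2) / 12 - (1 - (-1) ^ N) / 8)
      + (\<Sum>m<b. \<Sum>l<b. (sym_dev b s l m)\<^sup>2) * (2 * real N ^ 2 + 1) / 3
      + (\<Sum>m<b. \<Sum>l<b. sym_dev b s l m * sym_dev b s (Suc l) m) * (real N ^ 2 - 1) / 3"
proof -
  let ?D = "sym_dev N X" and ?G = "sym_dev b s"
  let ?w = "\<lambda>la l m. (1 - real la / real N) * ?G l m + real la / real N * ?G (Suc l) m"
  let ?k = "\<lambda>m. \<Sum>l<b. (hits s l m - hits s (b - 1 - l) m)\<^sup>2"
  let ?c = "\<lambda>la. \<Sum>mu<N. local_dev N X la mu * local_dev N X la (N - 1 - mu)"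
  \<comment> \<open>Minus the total correlation of the increments at mirrored heights, evaluated
    below.\<close>
  define U where "U = (real N ^ 2 + 2) / 12 - (1 - (-1) ^ N) / 8"
  define Q0 where "Q0 = (\<Sum>m<b. \<Sum>l<b. (?G l m)\<^sup>2)"
  define Q1 where "Q1 = (\<Sum>m<b. \<Sum>l<b. ?G l m * ?G (Suc l) m)"
  have "(\<Sum>i<b * N. \<Sum>j<b * N. (sym_dev (b * N) X' i j)\<^sup>2)
    = (\<Sum>l<b. \<Sum>la<N. \<Sum>mu<N. \<Sum>m<b. (sym_dev (b * N) X' (l * N + la) (mu * b + m))\<^sup>2)"
  proof -
    have *: "(\<Sum>j<b * N. f j) = (\<Sum>mu<N. \<Sum>m<b. f (mu * b + m))" for f :: "nat \<Rightarrow> real"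
      using sum_mult_block[of f N b] by (simp only: mult.commute)
    show ?thesis by (subst sum_mult_block[of _ b N]) (simp only: *)
  qed
  also have "\<dots> = (\<Sum>l<b. \<Sum>la<N. \<Sum>mu<N. \<Sum>m<b. (?D la mu + ?w la l m
      + (hits s l m * local_dev N X la mu + hits s (b - 1 - l) m * local_dev N X la (N - 1 - mu)))\<^sup>2)"
    by (intro sum.cong refl) (simp only: sym_dev_step lessThan_iff)
  also have "\<dots> = (\<Sum>la<N. \<Sum>m<b. \<Sum>l<b. \<Sum>mu<N. (?D la mu + ?w la l m
      + (hits s l m * local_dev N X la mu + hits s (b - 1 - l) m * local_dev N X la (N - 1 - mu)))\<^sup>2)"
    by (subst sum.swap, rule sum.cong[OF refl], subst sum.swap[of _ "{..<b}" "{..<N}"],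
        subst (2) sum.swap, subst sum.swap, subst (2) sum.swap) (rule refl)
  also have "\<dots> = (\<Sum>la<N. \<Sum>m<b. real b * (\<Sum>mu<N. (?D la mu)\<^sup>2) - ?k m * ?c la + real N * (\<Sum>l<b. (?w la l m)\<^sup>2))"
    by (intro sum.cong refl sum_sq_fixed) auto
  also have "\<dots> = real b ^ 2 * (\<Sum>la<N. \<Sum>mu<N. (?D la mu)\<^sup>2) - mirror_mismatch b s * (\<Sum>la<N. ?c la)
      + real N * (\<Sum>la<N. \<Sum>m<b. \<Sum>l<b. (?w la l m)\<^sup>2)"
    unfolding mirror_mismatch_def sum.distrib sum_subtractf sum_distrib_left[symmetric] sum_distrib_right[symmetric]
    by (simp add: sum_distrib_left sum_distrib_right power2_eq_square mult_ac)
  also have "(\<Sum>la<N. ?c la) = - U"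
  proof -
    have "(\<Sum>la<N. ?c la) = (\<Sum>la<N. real la - real (min la (N - la)) - real la ^ 2 / real N)"
      by (intro sum.cong refl sum_local_dev_mult_reflect[OF X_bij N_pos X_refl]) auto
    also have "\<dots> = real N * (real N - 1) / 2 - (real N ^ 2 / 4 - (1 - (-1) ^ N) / 8)
        - (real N - 1) * real N * (2 * real N - 1) / 6 / real N"
      by (simp only: sum_subtractf sum_divide_distrib[symmetric] sum_sawtooth_min sum_real_ids sum_real_squares)
    also have "\<dots> = - U" using N_pos unfolding U_def by (simp add: field_simps power2_eq_square)
    finally show ?thesis .
  qed
  also have "(\<Sum>la<N. \<Sum>m<b. \<Sum>l<b. (?w la l m)\<^sup>2) = (\<Sum>m<b. \<Sum>l<b. \<Sum>la<N. (?w la l m)\<^sup>2)"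
    by (subst sum.swap, rule sum.cong[OF refl], rule sum.swap)
  also have "\<dots> = (\<Sum>m<b. \<Sum>l<b. (?G l m)\<^sup>2 * ((real N + 1) * (2 * real N + 1) / (6 * real N))
      + ?G l m * ?G (Suc l) m * ((real N ^ 2 - 1) / (3 * real N))
      + (?G (Suc l) m)\<^sup>2 * ((real N - 1) * (2 * real N - 1) / (6 * real N)))"
    unfolding sum_sq_interpolation ..
  also have "\<dots> = Q0 * ((real N + 1) * (2 * real N + 1) / (6 * real N)) + Q1 * ((real N ^ 2 - 1) / (3 * real N))
      + (\<Sum>m<b. \<Sum>l<b. (?G (Suc l) m)\<^sup>2) * ((real N - 1) * (2 * real N - 1) / (6 * real N))"
    unfolding Q0_def Q1_def sum.distrib sum_distrib_right ..
  \<comment> \<open>\<open>sym_dev\<close> vanishes at 0 and \<open>b\<close>, so shifting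
    \<open>l\<close> changes nothing, and the unequal weights of the two ends of the interpolation
    merge into \<open>(2 * N^2 + 1) / 3\<close>.\<close>
  also have "(\<Sum>m<b. \<Sum>l<b. (?G (Suc l) m)\<^sup>2) = Q0"
    unfolding Q0_def
    by (intro sum.cong refl sum_shift_periodic[of "\<lambda>l. (?G l _)\<^sup>2"])
      (simp add: sym_dev_left_0[OF s_bij b_pos s_refl])
  also have "real b ^ 2 * (\<Sum>la<N. \<Sum>mu<N. (?D la mu)\<^sup>2) - mirror_mismatch b s * - U
      + real N * (Q0 * ((real N + 1) * (2 * real N + 1) / (6 * real N)) + Q1 * ((real N ^ 2 - 1) / (3 * real N))
        + Q0 * ((real N - 1) * (2 * real N - 1) / (6 * real N)))
    = real b ^ 2 * (\<Sum>la<N. \<Sum>mu<N. (?D la mu)\<^sup>2) + mirror_mismatch b s * U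
      + Q0 * (2 * real N ^ 2 + 1) / 3 + Q1 * (real N ^ 2 - 1) / 3"
    using N_pos by (simp add: field_simps power2_eq_square)
  finally show ?thesis unfolding U_def Q0_def Q1_def .
qed

end

section \<open>The functions phi and the constant\<close>

text \<open>On one cell the integral of a product of two linear functions is the trapezoidal value
  minus one sixth of the product of the increments, up to the factor \<open>1 / N\<close>.
  Periodicity merges the two ends of the trapezoids.\<close>

lemma has_integral_grid_product:
  fixes f :: "real \<Rightarrow> real" and u v :: "nat \<Rightarrow> real"
  assumes "N > 0" "u N = u 0" "v N = v 0"
    and "\<And>i x. i < N \<Longrightarrow> real i / real N < x \<Longrightarrow> x < real (Suc i) / real N \<Longrightarrow>
      f x = (u i + (real N * x - real i) * (u (Suc i) - u i)) * (v i + (real N * x - real i) * (v (Suc i) - v i))"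
  shows "(f has_integral ((\<Sum>i<N. u i * v i) - (\<Sum>i<N. (u (Suc i) - u i) * (v (Suc i) - v i)) / 6) / real N) {0..1}"
proof -
  let ?du = "\<lambda>i. u (Suc i) - u i" and ?dv = "\<lambda>i. v (Suc i) - v i"
  let ?p = "\<lambda>i. (u i - real i * ?du i) * (v i - real i * ?dv i)"
  let ?q = "\<lambda>i. real N * (?du i * (v i - real i * ?dv i) + (u i - real i * ?du i) * ?dv i)"
  let ?r = "\<lambda>i. real N ^ 2 * (?du i * ?dv i)"
  have "(f has_integral (\<Sum>i<N. ?p i / N + ?q i * (2 * real i + 1) / (2 * real N ^ 2)
    + ?r i * (3 * real i ^ 2 + 3 * real i + 1) / (3 * real N ^ 3))) {0..1}"
  proof (rule has_integral_grid_quadratic[OF assms(1)])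
    fix i x assume i: "i < N" "real i / real N < x" "x < real (Suc i) / real N"
    show "f x = ?p i + ?q i * x + ?r i * x ^ 2"
      unfolding assms(4)[OF i] by (simp add: algebra_simps power2_eq_square)
  qed
  also have "(\<Sum>i<N. ?p i / N + ?q i * (2 * real i + 1) / (2 * real N ^ 2)
      + ?r i * (3 * real i ^ 2 + 3 * real i + 1) / (3 * real N ^ 3))
    = (\<Sum>i<N. ((u i * v i + u (Suc i) * v (Suc i)) / 2 - ?du i * ?dv i / 6) / real N)"
  proof (intro sum.cong refl)
    fix i
    have "?p i / N + ?q i * (2 * real i + 1) / (2 * real N ^ 2)
        + ?r i * (3 * real i ^ 2 + 3 * real i + 1) / (3 * real N ^ 3)
      = (?p i + (?du i * (v i - real i * ?dv i) + (u i - real i * ?du i) * ?dv i) * (2 * real i + 1) / 2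
        + ?du i * ?dv i * (3 * real i ^ 2 + 3 * real i + 1) / 3) / real N"
      using assms(1) by (simp add: add_divide_distrib power2_eq_square power3_eq_cube)
    also have "\<dots> = ((u i * v i + u (Suc i) * v (Suc i)) / 2 - ?du i * ?dv i / 6) / real N"
      by (rule arg_cong[of _ _ "\<lambda>z. z / real N"]) (simp add: field_simps power2_eq_square)
    finally show "?p i / N + ?q i * (2 * real i + 1) / (2 * real N ^ 2)
        + ?r i * (3 * real i ^ 2 + 3 * real i + 1) / (3 * real N ^ 3)
      = ((u i * v i + u (Suc i) * v (Suc i)) / 2 - ?du i * ?dv i / 6) / real N" .
  qed
  also have "\<dots> = (((\<Sum>i<N. u i * v i) + (\<Sum>i<N. u (Suc i) * v (Suc i))) / 2 - (\<Sum>i<N. ?du i * ?dv i) / 6) / real N"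
    by (simp only: sum_divide_distrib[symmetric] sum_subtractf sum.distrib)
  also have "(\<Sum>i<N. u (Suc i) * v (Suc i)) = (\<Sum>i<N. u i * v i)"
    by (rule sum_shift_periodic[of "\<lambda>i. u i * v i"]) (simp add: assms)
  finally show ?thesis by simp
qed

lemma count_A_less:
  assumes "b > 0"
  shows "real (count_A b s 0 (real h / real b) k) = (\<Sum>a<k. of_bool (s a < h))"
proof -
  have "{M \<in> {1..k}. real (s (M - 1)) / real b \<in> {0..<real h / real b}} = Suc ` ({..<k} \<inter> {a. s a < h})"
    using assms by (auto simp: image_iff divide_less_cancel Suc_le_eq Bex_def) (metis Suc_pred diff_Suc_1 Suc_le_eq)
  then show ?thesis by (simp add: count_A_def card_image)
qed

lemma count_A_ge:
  assumes "b > 0" "\<And>a. a < k \<Longrightarrow> s a < b"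
  shows "real (count_A b s (real h / real b) 1 k) = real k - (\<Sum>a<k. of_bool (s a < h))"
proof -
  have "{M \<in> {1..k}. real (s (M - 1)) / real b \<in> {real h / real b..<1}} = Suc ` ({..<k} \<inter> {a. \<not> s a < h})"
    using assms by (auto simp: image_iff divide_le_cancel not_less Suc_le_eq Bex_def) (metis Suc_pred diff_Suc_1 Suc_le_eq)
  then have "real (count_A b s (real h / real b) 1 k) = (\<Sum>a<k. of_bool (\<not> s a < h))"
    by (simp add: count_A_def card_image)
  also have "\<dots> = (\<Sum>a<k. 1 - of_bool (s a < h))" by (intro sum.cong) auto
  finally show ?thesis by (simp add: sum_subtractf del: sum_of_bool_eq)
qed

text \<open>The two cases in the definition of \<open>phi\<close> are the two possible slopes,
  \<open>- h\<close> and \<open>b - h\<close>, according to whether the next digit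
  \<open>s i\<close> is at least \<open>h\<close>.\<close>

lemma phi_on_cell:
  fixes s :: "nat \<Rightarrow> nat"
  assumes "b > 0" "\<And>a. a < b \<Longrightarrow> s a < b" "i < b"
    and x: "real i / real b < x" "x < real (Suc i) / real b"
  shows "phi b h s x = (\<Sum>a<i. local_dev b s h a) + (real b * x - real i)
    * ((\<Sum>a<Suc i. local_dev b s h a) - (\<Sum>a<i. local_dev b s h a))"
proof -
  have bx: "real i < real b * x" "real b * x < real i + 1"
    using x assms(1) by (simp_all add: field_simps)
  have "x < 1"
    using x(2) assms(1,3) by (smt (verit, best) divide_le_eq_1 of_nat_0_less_iff of_nat_mono Suc_leI)
  moreover have "0 < x" using x(1) by (smt (verit) divide_nonneg_nonneg of_nat_0_le_iff)
  ultimately have "frac x = x" by (simp add: frac_eq)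
  moreover have "\<lfloor>real b * x\<rfloor> = int i" using bx by (simp add: floor_eq_iff)
  ultimately have phi: "phi b h s x = (if h \<le> s i
      then real (count_A b s 0 (real h / real b) (Suc i)) - real h * x
      else (real b - real h) * x - real (count_A b s (real h / real b) 1 (Suc i)))"
    by (simp add: phi_def phi_unit_def Let_def)
  have dev: "(\<Sum>a<k. local_dev b s h a) = (\<Sum>a<k. of_bool (s a < h)) - real k * real h / real b" for k
    unfolding local_dev_def by (simp only: sum_subtractf) simp
  have ge: "real (count_A b s (real h / real b) 1 (Suc i)) = real (Suc i) - (\<Sum>a<Suc i. of_bool (s a < h))"
    by (rule count_A_ge) (use assms in auto)
  show ?thesis
    unfolding phi count_A_less[OF assms(1)] ge dev
    using assms(1) by (auto simp: field_simps simp del: sum_of_bool_eq)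
qed

lemma has_integral_phi_mult:
  assumes "bij_betw s {..<b} {..<b}" "bij_betw s' {..<b} {..<b}" "b > 0" "h \<le> b" "h' \<le> b"
  shows "((\<lambda>x. phi b h s x * phi b h' s' x) has_integral
    ((\<Sum>m<b. (\<Sum>a<m. local_dev b s h a) * (\<Sum>a<m. local_dev b s' h' a))
      - (\<Sum>m<b. local_dev b s h m * local_dev b s' h' m) / 6) / real b) {0..1}"
proof -
  have lt: "\<And>a. a < b \<Longrightarrow> s a < b" "\<And>a. a < b \<Longrightarrow> s' a < b"
    using assms(1,2) by (auto simp: bij_betw_def)
  have "((\<lambda>x. phi b h s x * phi b h' s' x) has_integral
    ((\<Sum>m<b. (\<Sum>a<m. local_dev b s h a) * (\<Sum>a<m. local_dev b s' h' a))
      - (\<Sum>m<b. ((\<Sum>a<Suc m. local_dev b s h a) - (\<Sum>a<m. local_dev b s h a))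
          * ((\<Sum>a<Suc m. local_dev b s' h' a) - (\<Sum>a<m. local_dev b s' h' a))) / 6) / real b) {0..1}"
  proof (rule has_integral_grid_product[OF assms(3)])
    fix i x assume i: "i < b" "real i / real b < x" "x < real (Suc i) / real b"
    show "phi b h s x * phi b h' s' x =
      ((\<Sum>a<i. local_dev b s h a) + (real b * x - real i) * ((\<Sum>a<Suc i. local_dev b s h a) - (\<Sum>a<i. local_dev b s h a)))
      * ((\<Sum>a<i. local_dev b s' h' a) + (real b * x - real i) * ((\<Sum>a<Suc i. local_dev b s' h' a) - (\<Sum>a<i. local_dev b s' h' a)))"
      using phi_on_cell[where s = s and h = h, OF assms(3) lt(1) i]
        phi_on_cell[where s = s' and h = h', OF assms(3) lt(2) i] by simp
  qed (use assms in \<open>simp_all add: sum_local_dev\<close>)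
  then show ?thesis by simp
qed

text \<open>The combination of products defining \<open>c_const\<close>, rewritten so that neighbouring \<open>h\<close> enter only
  through differences.\<close>

lemma sum_periodic_combination:
  fixes u v :: "nat \<Rightarrow> real"
  assumes "u b = u 0" "v b = v 0"
  shows "2 * (\<Sum>l<b. u l * u l) + (\<Sum>l<b. u l * v l) + (\<Sum>l<b. u (Suc l) * v l + u l * v (Suc l)) / 2
    = 2 * (\<Sum>l<b. u l * u l) + 2 * (\<Sum>l<b. u l * v l) - (\<Sum>l<b. (u (Suc l) - u l) * (v (Suc l) - v l)) / 2"
  unfolding sum_diff_mult_periodic[of u b v, OF assms] by (simp add: diff_divide_distrib)

text \<open>Put \<open>w = u + v\<close>. The equal square sums of \<open>u\<close> and
  \<open>v\<close> express the products \<open>u l * v l\<close> by the squares of \<open>w\<close>,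
  and summation by parts for \<open>w\<close> then brings in its neighbouring products. Later
  \<open>w\<close> is \<open>sym_dev\<close>.\<close>

lemma sum_sq_periodic_combination:
  fixes u v :: "nat \<Rightarrow> real"
  assumes "u b = u 0" "v b = v 0" "(\<Sum>l<b. v l * v l) = (\<Sum>l<b. u l * u l)"
  shows "2 * (\<Sum>l<b. u l * u l) + (\<Sum>l<b. u l * v l) + (\<Sum>l<b. u (Suc l) * v l + u l * v (Suc l)) / 2
    = (2 * (\<Sum>l<b. (u l + v l)\<^sup>2) + (\<Sum>l<b. (u l + v l) * (u (Suc l) + v (Suc l)))) / 3
      + ((\<Sum>l<b. (u (Suc l) - u l)\<^sup>2) + (\<Sum>l<b. (v (Suc l) - v l)\<^sup>2)
        - (\<Sum>l<b. (u (Suc l) - u l) * (v (Suc l) - v l))) / 6"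
proof -
  let ?w = "\<lambda>l. u l + v l"
  have d: "(\<Sum>l<b. (?w (Suc l) - ?w l) * (?w (Suc l) - ?w l)) = (\<Sum>l<b. (u (Suc l) - u l)\<^sup>2)
      + (\<Sum>l<b. (v (Suc l) - v l)\<^sup>2) + 2 * (\<Sum>l<b. (u (Suc l) - u l) * (v (Suc l) - v l))"
    unfolding sum_distrib_left sum.distrib[symmetric]
    by (intro sum.cong refl) (simp add: power2_eq_square algebra_simps)
  have e: "(\<Sum>l<b. (?w (Suc l) - ?w l) * (?w (Suc l) - ?w l))
      = 2 * (\<Sum>l<b. (?w l)\<^sup>2) - 2 * (\<Sum>l<b. ?w l * ?w (Suc l))"
    using sum_diff_mult_periodic[of ?w b ?w] assms
    by (simp add: power2_eq_square sum_distrib_left mult_ac)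
  have q: "(\<Sum>l<b. (?w l)\<^sup>2) = 2 * (\<Sum>l<b. u l * u l) + 2 * (\<Sum>l<b. u l * v l)"
  proof -
    have "(\<Sum>l<b. (?w l)\<^sup>2) = (\<Sum>l<b. u l * u l) + (\<Sum>l<b. v l * v l) + 2 * (\<Sum>l<b. u l * v l)"
      unfolding sum_distrib_left sum.distrib[symmetric]
      by (intro sum.cong refl) (simp add: power2_eq_square algebra_simps)
    then show ?thesis using assms(3) by simp
  qed
  have alg: "2 * x + 2 * y - c / 2 = (2 * w + r) / 3 + (p + p' - c) / 6"
    if "t = p + p' + 2 * c" "t = 2 * w - 2 * r" "w = 2 * x + 2 * y" for t p p' c w r x y :: real
    using that by (simp add: field_simps)
  show ?thesis unfolding sum_periodic_combination[of u b v, OF assms(1,2)] by (rule alg[OF d e q])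
qed

lemma sum_self_mirror: "(\<Sum>m<b. of_bool (m = b - 1 - m)) = (1 - (-1) ^ b) / (2 :: real)"
proof (cases "even b")
  case True
  then have "m \<noteq> b - 1 - m" if "m < b" for m using that by presburger
  then show ?thesis using True by simp
next
  case False
  then obtain k where k: "b = 2 * k + 1" by (auto elim: oddE)
  have "(\<Sum>m<b. of_bool (m = b - 1 - m)) = (\<Sum>m<b. of_bool (m = k) :: real)"
    using k by (intro sum.cong) auto
  then show ?thesis using False by (simp add: of_bool_def k)
qed

section \<open>The constant \<open>c_const\<close> in terms of one-digit discrepancies\<close>

context
  fixes b :: nat and s :: "nat \<Rightarrow> nat"
  assumes bij: "bij_betw s {..<b} {..<b}" and b_pos: "b > 0"
    and s_refl: "\<And>y. y < b \<Longrightarrow> s (b - 1 - y) = b - 1 - s y"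
begin

text \<open>Since \<open>tau b (s a) = s (b - 1 - a)\<close>, composing with \<open>tau b\<close>
  just reads the digits from the end.\<close>

lemma local_dev_tau: "a < b \<Longrightarrow> local_dev b (tau b \<circ> s) h a = local_dev b s h (b - 1 - a)"
  using s_refl[of a] perm_less[OF bij b_pos s_refl, of a] by (simp add: local_dev_def tau_def)

lemma sum_local_dev_tau:
  "m \<le> b \<Longrightarrow> (\<Sum>a<m. local_dev b (tau b \<circ> s) h a) = (\<Sum>a<m. local_dev b s h (b - 1 - a))"
  by (intro sum.cong refl local_dev_tau) auto

lemma bij_tau: "bij_betw (tau b \<circ> s) {..<b} {..<b}"
proof (rule bij_betw_trans[OF bij])
  show "bij_betw (tau b) {..<b} {..<b}"
    by (rule bij_betw_byWitness[where f' = "tau b"]) (auto simp: tau_def)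
qed

text \<open>Composing with \<open>tau b\<close> merely exchanges the two summands of
  \<open>sym_dev\<close>. This is why the choice between the two permutations at each digit does not
  matter.\<close>

lemma sym_dev_tau:
  assumes "m \<le> b"
  shows "sym_dev b (tau b \<circ> s) l m = sym_dev b s l m"
  unfolding sym_dev_def
proof (intro sum.cong refl)
  fix a assume "a \<in> {..<m}"
  then have "a < b" "b - 1 - a < b" "b - 1 - (b - 1 - a) = a" using assms by auto
  then show "local_dev b (tau b \<circ> s) l a + local_dev b (tau b \<circ> s) l (b - 1 - a)
      = local_dev b s l a + local_dev b s l (b - 1 - a)"
    by (simp only: local_dev_tau add.commute)
qed

lemma local_dev_ends:
  assumes "a < b"
  shows "local_dev b s 0 a = 0" "local_dev b s b a = 0"
  using perm_less[OF bij b_pos s_refl assms] b_pos by (simp_all add: local_dev_def)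

lemma c_const_local_dev:
  "real b ^ 2 * c_const b s
    = (\<Sum>m<b. let u = \<lambda>h. \<Sum>a<m. local_dev b s h a; v = \<lambda>h. \<Sum>a<m. local_dev b s h (b - 1 - a) in
        2 * (\<Sum>h<b. u h * u h) + (\<Sum>h<b. u h * v h) + (\<Sum>h<b. u (Suc h) * v h + u h * v (Suc h)) / 2)
    - (\<Sum>m<b. let u = \<lambda>h. local_dev b s h m; v = \<lambda>h. local_dev b s h (b - 1 - m) in
        2 * (\<Sum>h<b. u h * u h) + (\<Sum>h<b. u h * v h) + (\<Sum>h<b. u (Suc h) * v h + u h * v (Suc h)) / 2) / 6"
proof -
  let ?u = "\<lambda>h m. \<Sum>a<m. local_dev b s h a" and ?v = "\<lambda>h m. \<Sum>a<m. local_dev b s h (b - 1 - a)"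
  let ?x = "\<lambda>h m. local_dev b s h m" and ?y = "\<lambda>h m. local_dev b s h (b - 1 - m)"
  have ss: "((\<lambda>x. phi b h s x * phi b h' s x) has_integral
    ((\<Sum>m<b. ?u h m * ?u h' m) - (\<Sum>m<b. ?x h m * ?x h' m) / 6) / real b) {0..1}"
    if "h \<le> b" "h' \<le> b" for h h'
    by (rule has_integral_phi_mult[OF bij bij b_pos that])
  have st: "((\<lambda>x. phi b h s x * phi b h' (tau b \<circ> s) x) has_integral
    ((\<Sum>m<b. ?u h m * ?v h' m) - (\<Sum>m<b. ?x h m * ?y h' m) / 6) / real b) {0..1}"
    if "h \<le> b" "h' \<le> b" for h h'
  proof -
    have "(\<Sum>m<b. ?u h m * ?v h' m) = (\<Sum>m<b. ?u h m * (\<Sum>a<m. local_dev b (tau b \<circ> s) h' a))"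
      "(\<Sum>m<b. ?x h m * ?y h' m) = (\<Sum>m<b. ?x h m * local_dev b (tau b \<circ> s) h' m)"
      by (intro sum.cong refl; simp only: sum_local_dev_tau local_dev_tau lessThan_iff less_imp_le)+
    then show ?thesis using has_integral_phi_mult[OF bij bij_tau b_pos that] by (simp only:)
  qed
  define A where "A h = (\<Sum>m<b. ?u h m * ?u h m) - (\<Sum>m<b. ?x h m * ?x h m) / 6" for h
  define B where "B h h' = (\<Sum>m<b. ?u h m * ?v h' m) - (\<Sum>m<b. ?x h m * ?y h' m) / 6" for h h'
  have "(phi_sq b s has_integral (\<Sum>h<b. A h / real b)) {0..1}"
    unfolding phi_sq_def power2_eq_square A_def by (intro has_integral_sum ss) auto
  then have 1: "real b ^ 2 * Phi_sq b s = (\<Sum>h<b. A h)"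
    using b_pos by (simp add: Phi_sq_def integral_unique sum_divide_distrib[symmetric] power2_eq_square)
  have "(phi_tilde b s has_integral (\<Sum>h<b. B h h / real b)) {0..1}"
    unfolding phi_tilde_def B_def by (intro has_integral_sum st) auto
  then have 2: "real b ^ 2 * Phi_tilde b s = (\<Sum>h<b. B h h)"
    using b_pos by (simp add: Phi_tilde_def integral_unique sum_divide_distrib[symmetric] power2_eq_square)
  have "(phi_tilde1 b s has_integral (\<Sum>h<b - 1. B (Suc h) h / real b)) {0..1}"
    unfolding phi_tilde1_def B_def Suc_eq_plus1[symmetric] by (intro has_integral_sum st) auto
  then have 3: "real b ^ 2 * Phi_tilde1 b s = (\<Sum>h<b - 1. B (Suc h) h)"
    using b_pos by (simp add: Phi_tilde1_def integral_unique sum_divide_distrib[symmetric] power2_eq_square)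
  have "(phi_tilde2 b s has_integral (\<Sum>h<b - 1. B h (Suc h) / real b)) {0..1}"
    unfolding phi_tilde2_def B_def Suc_eq_plus1[symmetric] by (intro has_integral_sum st) auto
  then have 4: "real b ^ 2 * Phi_tilde2 b s = (\<Sum>h<b - 1. B h (Suc h))"
    using b_pos by (simp add: Phi_tilde2_def integral_unique sum_divide_distrib[symmetric] power2_eq_square)
  obtain c where c: "b = Suc c" using b_pos by (cases b) auto
  have z: "local_dev b s b a = 0" "local_dev b s b (b - 1 - a) = 0" if "a < b" for a
    using local_dev_ends(2)[of a] local_dev_ends(2)[of "b - 1 - a"] that by simp_all
  \<comment> \<open>The sums defining \<open>phi_tilde1\<close> and \<open>phi_tilde2\<close> stop
    at \<open>b - 2\<close>. The missing terms involve \<open>h = b\<close>, where all deviations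
    vanish, so the sums can be taken cyclically.\<close>
  have "B b h = 0" for h unfolding B_def by (simp add: z)
  then have 5: "(\<Sum>h<b - 1. B (Suc h) h) = (\<Sum>h<b. B (Suc h) h)" using c by simp
  have "?v b m = 0" if "m < b" for m by (intro sum.neutral ballI z(2)) (use that in simp)
  then have "B h b = 0" for h unfolding B_def using z(2) by (simp del: diff_diff_left One_nat_def)
  then have 6: "(\<Sum>h<b - 1. B h (Suc h)) = (\<Sum>h<b. B h (Suc h))" using c by simp
  have "real b ^ 2 * c_const b s = 2 * (real b ^ 2 * Phi_sq b s) + real b ^ 2 * Phi_tilde b s
      + (real b ^ 2 * Phi_tilde1 b s + real b ^ 2 * Phi_tilde2 b s) / 2"
    by (simp add: c_const_def algebra_simps)
  also have "\<dots> = 2 * (\<Sum>h<b. A h) + (\<Sum>h<b. B h h) + (\<Sum>h<b. B (Suc h) h + B h (Suc h)) / 2"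
    unfolding 1 2 3 4 5 6 sum.distrib ..
  also have "(\<Sum>h<b. A h) = (\<Sum>m<b. \<Sum>h<b. ?u h m * ?u h m) - (\<Sum>m<b. \<Sum>h<b. ?x h m * ?x h m) / 6"
    unfolding A_def sum_subtractf sum_divide_distrib[symmetric]
    by (subst sum.swap, subst (3) sum.swap) (rule refl)
  also have "(\<Sum>h<b. B h h) = (\<Sum>m<b. \<Sum>h<b. ?u h m * ?v h m) - (\<Sum>m<b. \<Sum>h<b. ?x h m * ?y h m) / 6"
    unfolding B_def sum_subtractf sum_divide_distrib[symmetric]
    by (subst sum.swap, subst (3) sum.swap) (rule refl)
  also have "(\<Sum>h<b. B (Suc h) h + B h (Suc h)) =
      (\<Sum>m<b. \<Sum>h<b. ?u (Suc h) m * ?v h m + ?u h m * ?v (Suc h) m)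
      - (\<Sum>m<b. \<Sum>h<b. ?x (Suc h) m * ?y h m + ?x h m * ?y (Suc h) m) / 6"
    (is "?lhs = ?rhs")
  proof -
    have "?lhs = (\<Sum>h<b. \<Sum>m<b. ?u (Suc h) m * ?v h m + ?u h m * ?v (Suc h) m)
      - (\<Sum>h<b. \<Sum>m<b. ?x (Suc h) m * ?y h m + ?x h m * ?y (Suc h) m) / 6"
      unfolding B_def sum.distrib sum_subtractf sum_divide_distrib[symmetric]
      by (simp add: add_divide_distrib)
    also have "(\<Sum>h<b. \<Sum>m<b. ?u (Suc h) m * ?v h m + ?u h m * ?v (Suc h) m)
        = (\<Sum>m<b. \<Sum>h<b. ?u (Suc h) m * ?v h m + ?u h m * ?v (Suc h) m)"
      by (rule sum.swap)
    also have "(\<Sum>h<b. \<Sum>m<b. ?x (Suc h) m * ?y h m + ?x h m * ?y (Suc h) m)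
        = (\<Sum>m<b. \<Sum>h<b. ?x (Suc h) m * ?y h m + ?x h m * ?y (Suc h) m)"
      by (rule sum.swap)
    finally show ?thesis .
  qed
  finally show ?thesis
    unfolding Let_def sum.distrib sum_distrib_left[symmetric] sum_divide_distrib[symmetric]
    by (simp add: algebra_simps add_divide_distrib diff_divide_distrib)
qed

lemma local_dev_mirror: "h \<le> b \<Longrightarrow> a < b \<Longrightarrow> local_dev b s h (b - 1 - a) = - local_dev b s (b - h) a"
  using local_dev_reflect[OF bij b_pos s_refl, of h a] by simp

text \<open>The substitution of \<open>b - h\<close> for \<open>h\<close> turns the mirrored partial
  sums into the negatives of the original ones.\<close>

lemma sum_mirror_partial_sq:
  assumes "m \<le> b"
  shows "(\<Sum>h<b. (\<Sum>a<m. local_dev b s h (b - 1 - a)) * (\<Sum>a<m. local_dev b s h (b - 1 - a)))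
    = (\<Sum>h<b. (\<Sum>a<m. local_dev b s h a) * (\<Sum>a<m. local_dev b s h a))"
proof -
  let ?u = "\<lambda>h. \<Sum>a<m. local_dev b s h a"
  have "(\<Sum>h<b. (\<Sum>a<m. local_dev b s h (b - 1 - a)) * (\<Sum>a<m. local_dev b s h (b - 1 - a)))
      = (\<Sum>h<b. ?u (b - h) * ?u (b - h))"
  proof (intro sum.cong refl)
    fix h assume "h \<in> {..<b}"
    then have "(\<Sum>a<m. local_dev b s h (b - 1 - a)) = (\<Sum>a<m. - local_dev b s (b - h) a)"
      using assms by (intro sum.cong refl local_dev_mirror) auto
    then show "(\<Sum>a<m. local_dev b s h (b - 1 - a)) * (\<Sum>a<m. local_dev b s h (b - 1 - a)) = ?u (b - h) * ?u (b - h)"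
      by (simp only: sum_negf minus_mult_minus)
  qed
  also have "\<dots> = (\<Sum>h<b. ?u h * ?u h)"
    by (rule sum_shift_reflect[of "\<lambda>h. ?u h * ?u h"]) (use assms in \<open>simp add: local_dev_ends\<close>)
  finally show ?thesis .
qed

text \<open>An application of \<open>sum_sq_periodic_combination\<close> for each \<open>m\<close>:
  the two partial sums add up to \<open>sym_dev\<close>, and their increments in \<open>h\<close>
  are centred hit counts.\<close>

lemma partial_dev_combination:
  "(\<Sum>m<b. let u = \<lambda>h. \<Sum>a<m. local_dev b s h a; v = \<lambda>h. \<Sum>a<m. local_dev b s h (b - 1 - a) in
      2 * (\<Sum>h<b. u h * u h) + (\<Sum>h<b. u h * v h) + (\<Sum>h<b. u (Suc h) * v h + u h * v (Suc h)) / 2)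
    = (2 * (\<Sum>m<b. \<Sum>l<b. (sym_dev b s l m)\<^sup>2)
        + (\<Sum>m<b. \<Sum>l<b. sym_dev b s l m * sym_dev b s (Suc l) m)) / 3
      + (real b ^ 2 - 1) / 36 + mirror_mismatch b s / 12"
proof -
  let ?d = "\<lambda>l m. hits s l m - real m / real b"
  have "(\<Sum>m<b. let u = \<lambda>h. \<Sum>a<m. local_dev b s h a; v = \<lambda>h. \<Sum>a<m. local_dev b s h (b - 1 - a) in
      2 * (\<Sum>h<b. u h * u h) + (\<Sum>h<b. u h * v h) + (\<Sum>h<b. u (Suc h) * v h + u h * v (Suc h)) / 2)
    = (\<Sum>m<b. (2 * (\<Sum>l<b. (sym_dev b s l m)\<^sup>2)
        + (\<Sum>l<b. sym_dev b s l m * sym_dev b s (Suc l) m)) / 3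
      + ((\<Sum>l<b. (?d l m)\<^sup>2) + (\<Sum>l<b. (?d l m)\<^sup>2) - (\<Sum>l<b. ?d l m * ?d (b - 1 - l) m)) / 6)"
    unfolding Let_def
  proof (rule sum.cong[OF refl])
    fix m assume "m \<in> {..<b}"
    then have m: "m \<le> b" by simp
    let ?u = "\<lambda>h. \<Sum>a<m. local_dev b s h a" and ?v = "\<lambda>h. \<Sum>a<m. local_dev b s h (b - 1 - a)"
    have b0: "?u b = ?u 0" using m by (simp add: local_dev_ends)
    have b1: "?v b = ?v 0"
      by (intro sum.cong refl) (use m in \<open>simp add: local_dev_ends\<close>)
    have G: "sym_dev b s l m = ?u l + ?v l" for l by (simp only: sym_dev_def sum.distrib)
    have du: "?u (Suc l) - ?u l = ?d l m" for l
      by (rule partial_dev_Suc_left)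
    have dv: "?v (Suc l) - ?v l = ?d (b - 1 - l) m" if "l < b" for l
      by (rule partial_dev_reflect_Suc_left[OF bij b_pos s_refl that m])
    have dv2: "(\<Sum>l<b. (?v (Suc l) - ?v l)\<^sup>2) = (\<Sum>l<b. (?d l m)\<^sup>2)"
    proof -
      have "(\<Sum>l<b. (?v (Suc l) - ?v l)\<^sup>2) = (\<Sum>l<b. (?d (b - 1 - l) m)\<^sup>2)"
        by (intro sum.cong refl) (simp only: dv lessThan_iff)
      then show ?thesis by (simp only: sum_reflect[of "\<lambda>l. (?d l m)\<^sup>2" b])
    qed
    have duv: "(\<Sum>l<b. (?u (Suc l) - ?u l) * (?v (Suc l) - ?v l)) = (\<Sum>l<b. ?d l m * ?d (b - 1 - l) m)"
      by (intro sum.cong refl) (simp only: du dv lessThan_iff)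
    show "2 * (\<Sum>h<b. ?u h * ?u h) + (\<Sum>h<b. ?u h * ?v h) + (\<Sum>h<b. ?u (Suc h) * ?v h + ?u h * ?v (Suc h)) / 2
      = (2 * (\<Sum>l<b. (sym_dev b s l m)\<^sup>2)
        + (\<Sum>l<b. sym_dev b s l m * sym_dev b s (Suc l) m)) / 3
      + ((\<Sum>l<b. (?d l m)\<^sup>2) + (\<Sum>l<b. (?d l m)\<^sup>2) - (\<Sum>l<b. ?d l m * ?d (b - 1 - l) m)) / 6"
      unfolding sum_sq_periodic_combination[of ?u b ?v, OF b0 b1 sum_mirror_partial_sq[OF m]]
        dv2 duv unfolding du G ..
  qed
  also have "\<dots> = (2 * (\<Sum>m<b. \<Sum>l<b. (sym_dev b s l m)\<^sup>2)
        + (\<Sum>m<b. \<Sum>l<b. sym_dev b s l m * sym_dev b s (Suc l) m)) / 3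
      + ((\<Sum>m<b. \<Sum>l<b. (?d l m)\<^sup>2) + (\<Sum>m<b. \<Sum>l<b. (?d l m)\<^sup>2)
        - (\<Sum>m<b. \<Sum>l<b. ?d l m * ?d (b - 1 - l) m)) / 6"
    by (simp only: sum.distrib sum_subtractf sum_divide_distrib[symmetric] sum_distrib_left[symmetric])
  also have "\<dots> = (2 * (\<Sum>m<b. \<Sum>l<b. (sym_dev b s l m)\<^sup>2)
        + (\<Sum>m<b. \<Sum>l<b. sym_dev b s l m * sym_dev b s (Suc l) m)) / 3
      + (real b ^ 2 - 1) / 36 + mirror_mismatch b s / 12"
    by (simp only: sum_hits_dev_sq[OF bij b_pos s_refl] sum_hits_dev_mirror[OF bij b_pos s_refl])
      (simp add: field_simps)
  finally show ?thesis .
qed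

text \<open>Neither the permutation nor the parity of \<open>b\<close> survives: the parity term of
  the sawtooth sum cancels that of the self-mirrored middle digit.\<close>

lemma local_dev_combination:
  "(\<Sum>m<b. let u = \<lambda>h. local_dev b s h m; v = \<lambda>h. local_dev b s h (b - 1 - m) in
      2 * (\<Sum>h<b. u h * u h) + (\<Sum>h<b. u h * v h) + (\<Sum>h<b. u (Suc h) * v h + u h * v (Suc h)) / 2)
    = (real b ^ 2 - 1) / 6"
proof -
  let ?x = "\<lambda>h m. local_dev b s h m" and ?y = "\<lambda>h m. local_dev b s h (b - 1 - m)"
  have m1: "b - 1 - m < b" for m using b_pos by auto
  have ends: "?x b m = ?x 0 m" "?y b m = ?y 0 m" if "m < b" for m
    using local_dev_ends[OF that] local_dev_ends[OF m1[of m]] by simp_all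
  have "(\<Sum>m<b. let u = \<lambda>h. local_dev b s h m; v = \<lambda>h. local_dev b s h (b - 1 - m) in
      2 * (\<Sum>h<b. u h * u h) + (\<Sum>h<b. u h * v h) + (\<Sum>h<b. u (Suc h) * v h + u h * v (Suc h)) / 2)
    = (\<Sum>m<b. 2 * (\<Sum>h<b. ?x h m * ?x h m) + 2 * (\<Sum>h<b. ?x h m * ?y h m)
        - (\<Sum>h<b. (?x (Suc h) m - ?x h m) * (?y (Suc h) m - ?y h m)) / 2)"
    unfolding Let_def
    by (intro sum.cong refl sum_periodic_combination[of "\<lambda>h. ?x h _" b "\<lambda>h. ?y h _"])
      (simp_all only: ends lessThan_iff)
  also have "\<dots> = 2 * (\<Sum>m<b. \<Sum>h<b. ?x h m * ?x h m) + 2 * (\<Sum>m<b. \<Sum>h<b. ?x h m * ?y h m)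
        - (\<Sum>m<b. \<Sum>h<b. (?x (Suc h) m - ?x h m) * (?y (Suc h) m - ?y h m)) / 2"
    by (simp only: sum.distrib sum_subtractf sum_divide_distrib[symmetric] sum_distrib_left[symmetric])
  also have "(\<Sum>m<b. \<Sum>h<b. ?x h m * ?x h m) = (\<Sum>h<b. real h - real h ^ 2 / real b)"
  proof (subst sum.swap, intro sum.cong refl)
    fix h assume "h \<in> {..<b}"
    then have h: "h \<le> b" by simp
    have "(\<Sum>m<b. of_bool (s m < h)) = real h"
      using h by (simp add: sum_perm[OF bij b_pos, of "\<lambda>x. of_bool (x < h)"] sum_of_bool_less del: sum_of_bool_eq)
    moreover have "?x h m * ?x h m = (1 - 2 * real h / real b) * of_bool (s m < h) + (real h / real b) ^ 2" for m
      by (auto simp: local_dev_def of_bool_def power2_eq_square algebra_simps)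
    ultimately have "(\<Sum>m<b. ?x h m * ?x h m) = (1 - 2 * real h / real b) * real h + real b * (real h / real b) ^ 2"
      by (simp add: sum.distrib sum_distrib_left[symmetric] del: sum_of_bool_eq)
    then show "(\<Sum>m<b. ?x h m * ?x h m) = real h - real h ^ 2 / real b"
      using b_pos by (simp add: field_simps power2_eq_square)
  qed
  also have "\<dots> = real b * (real b - 1) / 2 - (real b - 1) * real b * (2 * real b - 1) / 6 / real b"
    by (simp only: sum_subtractf sum_divide_distrib[symmetric] sum_real_ids sum_real_squares)
  also have "(\<Sum>m<b. \<Sum>h<b. ?x h m * ?y h m) = (\<Sum>h<b. real h - real (min h (b - h)) - real h ^ 2 / real b)"
    by (subst sum.swap, intro sum.cong refl sum_local_dev_mult_reflect[OF bij b_pos s_refl]) auto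
  also have "\<dots> = real b * (real b - 1) / 2 - (real b ^ 2 / 4 - (1 - (-1) ^ b) / 8)
      - (real b - 1) * real b * (2 * real b - 1) / 6 / real b"
    by (simp only: sum_subtractf sum_divide_distrib[symmetric] sum_sawtooth_min sum_real_ids sum_real_squares)
  also have "(\<Sum>m<b. \<Sum>h<b. (?x (Suc h) m - ?x h m) * (?y (Suc h) m - ?y h m)) = (\<Sum>m<b. of_bool (m = b - 1 - m) - 1 / real b)"
  proof (intro sum.cong refl)
    fix m assume "m \<in> {..<b}"
    then have m: "m < b" by simp
    have p: "s m < b" "s (b - 1 - m) < b" using perm_less[OF bij b_pos s_refl] m m1 by blast+
    have "(\<Sum>h<b. (?x (Suc h) m - ?x h m) * (?y (Suc h) m - ?y h m))
        = (\<Sum>h<b. of_bool (h = s m \<and> m = b - 1 - m) - of_bool (h = s m) / real b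
            - of_bool (h = s (b - 1 - m)) / real b + 1 / real b ^ 2)"
    proof (intro sum.cong refl)
      fix h
      \<comment> \<open>Both indicators are 1 for the same \<open>h\<close> only if \<open>s\<close>
        agrees at \<open>m\<close> and its mirror image; by injectivity \<open>m\<close> is then the
        middle position.\<close>
      have "s m = s (b - 1 - m) \<longleftrightarrow> m = b - 1 - m" by (rule s_eq_iff[OF bij b_pos s_refl m m1])
      then have "of_bool (h = s m \<and> m = b - 1 - m) = (of_bool (s m = h) * of_bool (s (b - 1 - m) = h) :: real)"
        by auto
      then show "(?x (Suc h) m - ?x h m) * (?y (Suc h) m - ?y h m)
        = of_bool (h = s m \<and> m = b - 1 - m) - of_bool (h = s m) / real b
            - of_bool (h = s (b - 1 - m)) / real b + 1 / real b ^ 2"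
        unfolding local_dev_Suc_left
        by (simp add: power2_eq_square algebra_simps eq_commute[of h])
    qed
    also have "\<dots> = of_bool (m = b - 1 - m) - 1 / real b - 1 / real b + real b * (1 / real b ^ 2)"
      using p by (simp add: sum.distrib sum_subtractf sum_divide_distrib[symmetric] of_bool_def
          del: One_nat_def diff_diff_left)
    also have "\<dots> = of_bool (m = b - 1 - m) - 1 / real b"
      using b_pos by (simp add: power2_eq_square)
    finally show "(\<Sum>h<b. (?x (Suc h) m - ?x h m) * (?y (Suc h) m - ?y h m)) = of_bool (m = b - 1 - m) - 1 / real b" .
  qed
  also have "\<dots> = (1 - (-1) ^ b) / 2 - 1"
    unfolding sum_subtractf sum_self_mirror using b_pos by simp
  also have "2 * (real b * (real b - 1) / 2 - (real b - 1) * real b * (2 * real b - 1) / 6 / real b)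
      + 2 * (real b * (real b - 1) / 2 - (real b ^ 2 / 4 - (1 - (-1) ^ b) / 8)
        - (real b - 1) * real b * (2 * real b - 1) / 6 / real b) - ((1 - (-1) ^ b) / 2 - 1) / 2
    = (real b ^ 2 - 1) / 6"
    using b_pos by (simp add: field_simps power2_eq_square)
  finally show ?thesis .
qed

text \<open>One sixth of \<open>local_dev_combination\<close> cancels the term
  \<open>(b^2 - 1) / 36\<close> of \<open>partial_dev_combination\<close>.\<close>

lemma c_const_sym_dev:
  "real b ^ 2 * c_const b s = (2 * (\<Sum>m<b. \<Sum>l<b. (sym_dev b s l m)\<^sup>2)
        + (\<Sum>m<b. \<Sum>l<b. sym_dev b s l m * sym_dev b s (Suc l) m)) / 3 + mirror_mismatch b s / 12"
  unfolding c_const_local_dev partial_dev_combination local_dev_combination by simp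

text \<open>Half the square sum of the increments of \<open>sym_dev\<close> in \<open>l\<close>.
  Together with \<open>c_const_sym_dev\<close> it removes both quadratic sums from the
  recursion.\<close>

lemma sum_sym_dev_sq_diff:
  "(\<Sum>m<b. \<Sum>l<b. (sym_dev b s l m)\<^sup>2) - (\<Sum>m<b. \<Sum>l<b. sym_dev b s l m * sym_dev b s (Suc l) m)
    = (real b ^ 2 - 1) / 3 - mirror_mismatch b s / 2"
proof -
  let ?d = "\<lambda>l m. hits s l m - real m / real b" and ?G = "sym_dev b s"
  have "2 * ((\<Sum>l<b. (?G l m)\<^sup>2) - (\<Sum>l<b. ?G l m * ?G (Suc l) m))
      = 2 * (\<Sum>l<b. (?d l m)\<^sup>2) + 2 * (\<Sum>l<b. ?d l m * ?d (b - 1 - l) m)" if "m < b" for m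
  proof -
    have m: "m \<le> b" using that by simp
    have dG: "?G (Suc l) m - ?G l m = ?d l m + ?d (b - 1 - l) m" if "l < b" for l
    proof -
      have "(\<Sum>a<m. local_dev b s (Suc l) (b - 1 - a)) - (\<Sum>a<m. local_dev b s l (b - 1 - a)) = ?d (b - 1 - l) m"
        by (rule partial_dev_reflect_Suc_left[OF bij b_pos s_refl that m])
      then show ?thesis
        using partial_dev_Suc_left[of b s l m] unfolding sym_dev_def sum.distrib by linarith
    qed
    have "2 * ((\<Sum>l<b. (?G l m)\<^sup>2) - (\<Sum>l<b. ?G l m * ?G (Suc l) m))
        = (\<Sum>l<b. (?G (Suc l) m - ?G l m) * (?G (Suc l) m - ?G l m))"
      using sum_diff_mult_periodic[of "\<lambda>l. ?G l m" b "\<lambda>l. ?G l m"] m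
      by (simp add: sym_dev_left_0[OF bij b_pos s_refl] power2_eq_square sum_distrib_left mult_ac right_diff_distrib)
    also have "\<dots> = (\<Sum>l<b. (?d l m)\<^sup>2 + (?d (b - 1 - l) m)\<^sup>2 + 2 * (?d l m * ?d (b - 1 - l) m))"
      by (intro sum.cong refl) (simp only: dG lessThan_iff power2_eq_square algebra_simps)
    also have "\<dots> = 2 * (\<Sum>l<b. (?d l m)\<^sup>2) + 2 * (\<Sum>l<b. ?d l m * ?d (b - 1 - l) m)"
      unfolding sum.distrib sum_distrib_left[symmetric] sum_reflect[of "\<lambda>l. (?d l m)\<^sup>2"] by simp
    finally show ?thesis .
  qed
  then have "(\<Sum>m<b. (\<Sum>l<b. (?G l m)\<^sup>2) - (\<Sum>l<b. ?G l m * ?G (Suc l) m))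
      = (\<Sum>m<b. (\<Sum>l<b. (?d l m)\<^sup>2) + (\<Sum>l<b. ?d l m * ?d (b - 1 - l) m))"
    by (intro sum.cong refl) fastforce
  then have "(\<Sum>m<b. \<Sum>l<b. (?G l m)\<^sup>2) - (\<Sum>m<b. \<Sum>l<b. ?G l m * ?G (Suc l) m)
      = (\<Sum>m<b. \<Sum>l<b. (?d l m)\<^sup>2) + (\<Sum>m<b. \<Sum>l<b. ?d l m * ?d (b - 1 - l) m)"
    by (simp only: sum_subtractf sum.distrib)
  also have "\<dots> = (real b ^ 2 - 1) / 3 - mirror_mismatch b s / 2"
    by (simp only: sum_hits_dev_sq[OF bij b_pos s_refl] sum_hits_dev_mirror[OF bij b_pos s_refl])
  finally show ?thesis .
qed

end

section \<open>Applying the abstract results to Hammersley sets\<close>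

lemma sym_hammersley_eq_sym_points:
  assumes "b > 0" "\<And>i x. i < n \<Longrightarrow> x < b \<Longrightarrow> S i x < b"
    "\<And>i. i < n \<Longrightarrow> S i \<circ> tau b = tau b \<circ> S i"
  shows "sym_hammersley b n S = sym_points (b ^ n) (hamm_x b S n)"
proof -
  have "hamm_x b (\<lambda>i. tau b \<circ> S i) n y = hamm_x b S n (b ^ n - 1 - y)" if "y < b ^ n" for y
    using hamm_x_tau[of n b S y] hamm_x_reflect[of n b S y] assms that by simp
  then have "(\<lambda>y. (real (hamm_x b (\<lambda>i. tau b \<circ> S i) n y) / real b ^ n, real y / real b ^ n)) ` {..<b ^ n}
      = (\<lambda>y. (real (hamm_x b S n (b ^ n - 1 - y)) / real b ^ n, real y / real b ^ n)) ` {..<b ^ n}"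
    by (intro image_cong refl) simp
  then show ?thesis
    unfolding sym_hammersley_def hammersley_eq_image[OF assms(1)] sym_points_def of_nat_power by simp
qed

lemma permutes_tau: "tau b permutes {..<b}"
  by (rule bij_imp_permutes[OF bij_betw_byWitness[where f' = "tau b"]]) (auto simp: tau_def)

lemma digit_permutation:
  assumes "s permutes {..<b}" "s \<circ> tau b = tau b \<circ> s" "p \<in> {s, tau b \<circ> s}"
  shows "p permutes {..<b} \<and> p \<circ> tau b = tau b \<circ> p"
proof -
  have "p = s \<or> p = tau b \<circ> s" using assms(3) by blast
  then show ?thesis
    using assms(1,2) permutes_compose[OF assms(1) permutes_tau] by (auto simp: comp_assoc)
qed

lemma tau_commute_reflect:
  assumes "s \<circ> tau b = tau b \<circ> s" "s permutes {..<b}" "y < b"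
  shows "s (b - 1 - y) = b - 1 - s y"
proof -
  have "s y < b" using permutes_in_image[OF assms(2), of y] assms(3) by simp
  then show ?thesis using fun_cong[OF assms(1), of y] assms(3) by (simp add: tau_def)
qed

section \<open>The closed form\<close>

text \<open>The terms with \<open>Q0\<close> and \<open>Q1\<close> regroup as
  \<open>N^2 * (2 * Q0 + Q1) / 3 + (Q0 - Q1) / 3\<close>, the combinations known from
  \<open>c\<close> and \<open>Q\<close>. The exponent \<open>m\<close> carries the parity of the
  grid size separately from the real number \<open>N\<close>.\<close>

lemma parity_recursion:
  fixes B N n c K Q0 Q1 :: real
  assumes c: "B ^ 2 * c = (2 * Q0 + Q1) / 3 + K / 12"
    and Q: "Q0 - Q1 = (B ^ 2 - 1) / 3 - K / 2"
    and K: "K = (B ^ 2 - 1) / 2 + (1 + (-1) ^ b) / 4"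
  shows "B ^ 2 * (N ^ 2 * (n * c - 1 / 72) - (7 + 9 * (-1) ^ m) / 144)
      + K * ((N ^ 2 + 2) / 12 - (1 - (-1) ^ m) / 8) + Q0 * (2 * N ^ 2 + 1) / 3 + Q1 * (N ^ 2 - 1) / 3
    = (B * N) ^ 2 * ((n + 1) * c - 1 / 72) - (7 + 9 * (-1) ^ (b * m)) / 144"
proof -
  have "N ^ 2 * (B ^ 2 * c) = N ^ 2 * ((2 * Q0 + Q1) / 3 + K / 12)" by (simp only: c)
  then have "Q0 * (2 * N ^ 2 + 1) / 3 + Q1 * (N ^ 2 - 1) / 3
      = N ^ 2 * (B ^ 2 * c) - N ^ 2 * K / 12 + (Q0 - Q1) / 3"
    by (simp add: field_simps)
  \<comment> \<open>The part free of \<open>N^2\<close>, checked for the four parities of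
    \<open>b\<close> and \<open>m\<close>.\<close>
  moreover have "- (B ^ 2) * (7 + 9 * (-1) ^ m) / 144 + K * (2 / 12 - (1 - (-1) ^ m) / 8) + (Q0 - Q1) / 3
      + (7 + 9 * (-1) ^ (b * m)) / 144 = 0"
    unfolding Q K
    by (cases "even b"; cases "even m") (simp_all add: field_simps)
  ultimately show ?thesis by (simp add: field_simps power_mult_distrib)
qed

lemma sum_sym_dev_sq_closed_form:
  assumes b: "b > 0" and s: "s permutes {..<b}" "s \<circ> tau b = tau b \<circ> s"
    and S: "\<And>i. i < n \<Longrightarrow> S i \<in> {s, tau b \<circ> s}"
  shows "(\<Sum>i<b ^ n. \<Sum>j<b ^ n. (sym_dev (b ^ n) (hamm_x b S n) i j)\<^sup>2)
    = (real b ^ n) ^ 2 * (real n * c_const b s - 1 / 72) - (7 + 9 * (-1) ^ (b ^ n)) / 144"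
  using S
proof (induction n)
  case 0
  \<comment> \<open>A one-cell grid has \<open>sym_dev\<close> equal to 0 at its only index, and
    \<open>- 1 / 72 - (7 - 9) / 144 = 0\<close>.\<close>
  show ?case by (simp add: sym_dev_def)
next
  case (Suc n)
  have s_bij: "bij_betw s {..<b} {..<b}" using s(1) by (rule permutes_imp_bij)
  have s_refl: "s (b - 1 - y) = b - 1 - s y" if "y < b" for y
    by (rule tau_commute_reflect[OF s(2,1) that])
  have "S i permutes {..<b} \<and> S i \<circ> tau b = tau b \<circ> S i" if "i < Suc n" for i
    using Suc.prems[OF that] by (rule digit_permutation[OF s])
  then have perm: "S i permutes {..<b}" and comm: "S i \<circ> tau b = tau b \<circ> S i" if "i < Suc n" for i
    using that by blast+
  have lt: "S i x < b" if "i < Suc n" "x < b" for i x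
    using permutes_in_image[OF perm[OF that(1)], of x] that(2) by simp
  let ?N = "b ^ n" and ?X = "hamm_x b S n" and ?t = "S n"
  have t_bij: "bij_betw ?t {..<b} {..<b}" using perm[of n] permutes_imp_bij by blast
  have t_refl: "?t (b - 1 - y) = b - 1 - ?t y" if "y < b" for y
    by (rule tau_commute_reflect[OF comm perm that]) simp_all
  have X_bij: "bij_betw ?X {..<?N} {..<?N}" by (rule hamm_x_bij) (use perm b in auto)
  have X_refl: "?X (?N - 1 - y) = ?N - 1 - ?X y" if "y < ?N" for y
    by (rule hamm_x_reflect) (use lt b that comm in auto)
  have G: "sym_dev b ?t l m = sym_dev b s l m" if "m < b" for l m
  proof -
    have "sym_dev b (tau b \<circ> s) l m = sym_dev b s l m"
      by (rule sym_dev_tau[OF s_bij b s_refl]) (use that in auto)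
    moreover have "?t = s \<or> ?t = tau b \<circ> s" using Suc.prems[of n] by blast
    ultimately show ?thesis by (elim disjE) (simp_all only:)
  qed
  have K: "mirror_mismatch b r = (real b ^ 2 - 1) / 2 + (1 + (-1) ^ b) / 4"
    if "bij_betw r {..<b} {..<b}" "\<And>y. y < b \<Longrightarrow> r (b - 1 - y) = b - 1 - r y" for r
    by (rule mirror_mismatch_eq[OF that(1) b that(2)])
  have Kt: "mirror_mismatch b ?t = mirror_mismatch b s"
    using K[OF s_bij s_refl] K[OF t_bij t_refl] by simp
  have N: "?N > 0" using b by simp
  define Q0 where "Q0 = (\<Sum>m<b. \<Sum>l<b. (sym_dev b s l m)\<^sup>2)"
  define Q1 where "Q1 = (\<Sum>m<b. \<Sum>l<b. sym_dev b s l m * sym_dev b s (Suc l) m)"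
  have "hamm_x b S (Suc n) = (\<lambda>y. ?X (y div b) + ?t (y mod b) * ?N)" by (rule ext) simp
  then have "(\<Sum>i<b ^ Suc n. \<Sum>j<b ^ Suc n. (sym_dev (b ^ Suc n) (hamm_x b S (Suc n)) i j)\<^sup>2)
    = (\<Sum>i<b * ?N. \<Sum>j<b * ?N. (sym_dev (b * ?N) (\<lambda>y. ?X (y div b) + ?t (y mod b) * ?N) i j)\<^sup>2)"
    by simp
  also have "\<dots> = real b ^ 2 * (\<Sum>i<?N. \<Sum>j<?N. (sym_dev ?N ?X i j)\<^sup>2)
      + mirror_mismatch b ?t * ((real ?N ^ 2 + 2) / 12 - (1 - (-1) ^ ?N) / 8)
      + (\<Sum>m<b. \<Sum>l<b. (sym_dev b ?t l m)\<^sup>2) * (2 * real ?N ^ 2 + 1) / 3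
      + (\<Sum>m<b. \<Sum>l<b. sym_dev b ?t l m * sym_dev b ?t (Suc l) m) * (real ?N ^ 2 - 1) / 3"
    by (rule sum_sym_dev_sq_step[OF t_bij b t_refl X_bij N X_refl])
  also have "(\<Sum>m<b. \<Sum>l<b. (sym_dev b ?t l m)\<^sup>2) = Q0"
    unfolding Q0_def by (intro sum.cong refl) (simp only: G lessThan_iff)
  also have "(\<Sum>m<b. \<Sum>l<b. sym_dev b ?t l m * sym_dev b ?t (Suc l) m) = Q1"
    unfolding Q1_def by (intro sum.cong refl) (simp only: G lessThan_iff)
  also have "(\<Sum>i<?N. \<Sum>j<?N. (sym_dev ?N ?X i j)\<^sup>2)
      = real ?N ^ 2 * (real n * c_const b s - 1 / 72) - (7 + 9 * (-1) ^ ?N) / 144"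
    using Suc by simp
  also have "real b ^ 2 * (real ?N ^ 2 * (real n * c_const b s - 1 / 72) - (7 + 9 * (-1) ^ ?N) / 144)
      + mirror_mismatch b ?t * ((real ?N ^ 2 + 2) / 12 - (1 - (-1) ^ ?N) / 8)
      + Q0 * (2 * real ?N ^ 2 + 1) / 3 + Q1 * (real ?N ^ 2 - 1) / 3
    = (real b * real ?N) ^ 2 * ((real n + 1) * c_const b s - 1 / 72) - (7 + 9 * (-1) ^ (b * ?N)) / 144"
    unfolding Kt
  proof (rule parity_recursion)
    show "real b ^ 2 * c_const b s = (2 * Q0 + Q1) / 3 + mirror_mismatch b s / 12"
      unfolding Q0_def Q1_def by (rule c_const_sym_dev[OF s_bij b s_refl])
    show "Q0 - Q1 = (real b ^ 2 - 1) / 3 - mirror_mismatch b s / 2"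
      unfolding Q0_def Q1_def by (rule sum_sym_dev_sq_diff[OF s_bij b s_refl])
  qed (rule K[OF s_bij s_refl])
  finally show ?case by (simp add: add.commute)
qed

theorem theorem1:
  fixes b n :: nat
    and \<sigma> :: "nat \<Rightarrow> nat"
    and S :: "nat \<Rightarrow> nat \<Rightarrow> nat"
  assumes "b \<ge> 2"
    and "\<sigma> permutes {..<b}"
    and "\<sigma> \<circ> tau b = tau b \<circ> \<sigma>"
    and "n \<ge> 1"
    and "\<forall>i<n. S i \<in> {\<sigma>, tau b \<circ> \<sigma>}"
  shows "(2 * real b ^ n * L2_discrepancy (sym_hammersley b n S))\<^sup>2 =
           real n * c_const b \<sigma> + 11 / 8 + 1 / real b ^ n
             + (1 - 9 * (-1) ^ b) / (144 * real b ^ (2 * n))"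
proof -
  have b: "b > 0" using assms(1) by simp
  have "S i permutes {..<b} \<and> S i \<circ> tau b = tau b \<circ> S i" if "i < n" for i
    using assms(5) that by (intro digit_permutation[OF assms(2,3)]) blast
  then have perm: "S i permutes {..<b}" and comm: "S i \<circ> tau b = tau b \<circ> S i" if "i < n" for i
    using that by blast+
  have lt: "S i x < b" if "i < n" "x < b" for i x
    using permutes_in_image[OF perm[OF that(1)], of x] that(2) by simp
  let ?N = "b ^ n" and ?X = "hamm_x b S n"
  let ?P = "sym_points ?N ?X"
  define I where "I = integral {0..1} (\<lambda>y. integral {0..1} (\<lambda>x. \<bar>discr_E x y ?P\<bar>\<^sup>2))"
  have X_refl: "?X (?N - 1 - y) = ?N - 1 - ?X y" if "y < ?N" for y
    by (rule hamm_x_reflect) (use lt b that comm in auto)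
  have I: "I = (\<Sum>i<?N. \<Sum>j<?N. (sym_dev ?N ?X i j)\<^sup>2) / real ?N ^ 2
      + 25 / 18 + 1 / real ?N + 1 / (18 * real ?N ^ 2)"
    unfolding I_def
    by (rule integral_discr_E_sym_points[OF hamm_x_bij _ X_refl]) (use perm b in auto)
  \<comment> \<open>Nonnegativity allows the square to undo the root in
    \<open>L2_discrepancy\<close>.\<close>
  have "I \<ge> 0" unfolding I by (intro add_nonneg_nonneg divide_nonneg_nonneg sum_nonneg) auto
  moreover have "sym_hammersley b n S = ?P"
    by (rule sym_hammersley_eq_sym_points) (use b lt comm in auto)
  moreover have "real (size ?P) = 2 * real ?N" using size_sym_points[of ?N ?X] b by simp
  ultimately have "(2 * real b ^ n * L2_discrepancy (sym_hammersley b n S))\<^sup>2 = I"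
    using b by (simp only: L2_discrepancy_def I_def[symmetric]) simp
  also have "I = (real ?N ^ 2 * (real n * c_const b \<sigma> - 1 / 72) - (7 + 9 * (-1) ^ ?N) / 144) / real ?N ^ 2
      + 25 / 18 + 1 / real ?N + 1 / (18 * real ?N ^ 2)"
    unfolding I using sum_sym_dev_sq_closed_form[OF b assms(2,3), of n S] assms(5) by simp
  \<comment> \<open>For \<open>n = 0\<close> the power would be odd whatever \<open>b\<close> is;
    \<open>n \<ge> 1\<close> gives \<open>b ^ n\<close> the parity of \<open>b\<close>.\<close>
  also have "(-1 :: real) ^ ?N = (-1) ^ b" using assms(4) by (cases "even b") auto
  \<comment> \<open>The constants combine as \<open>25/18 - 1/72 = 11/8\<close> and, with
    \<open>e = (-1)^b\<close>, \<open>1/18 - (7 + 9 e)/144 = (1 - 9 e)/144\<close>.\<close>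
  also have "(real ?N ^ 2 * (real n * c_const b \<sigma> - 1 / 72) - (7 + 9 * (-1) ^ b) / 144) / real ?N ^ 2
      + 25 / 18 + 1 / real ?N + 1 / (18 * real ?N ^ 2)
    = real n * c_const b \<sigma> + 11 / 8 + 1 / real ?N + (1 - 9 * (-1) ^ b) / (144 * real ?N ^ 2)"
    using b by (simp add: field_simps)
  finally show ?thesis by (simp add: power_mult[symmetric] mult.commute)
qed

end
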